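(* Let $p,q\in\mathbb{Z}$ with $q-p^2/4>0$, let $\tau\in\mathbb{C}$ satisfy $\tau^2-p\tau+q=0$, let $w\ge 2$ be an integer and let $\mathcal{D}$ be the minimal norm representatives digit set modulo $\tau^w$. Suppose that one of the following conditions holds: (i) $w\ge 4$ and $|p|\ge 3$; (ii) $w=3$ and $|p|\ge 5$; (iii) $w=3$, $|p|=4$ and $5\le q\le 9$; (iv) $w=2$, $p$ is even, and $\left(\frac{1}{\sqrt q}+\frac2q\right)^2\left(q-\frac{p^2}{4}+1\right)<1$ or, equivalently, $|p|>2\sqrt{q+1-\frac{q^2}{(2+\sqrt q)^2}}$; (v) $w=2$, $p$ is odd, and $\left(\frac{1}{\sqrt q}+\frac2q\right)^2\left(q-\frac{p^2}{4}+\frac14\right)^2\left(q-\frac{p^2}{4}\right)^{-1}<1$. Then the $w$-NAF-expansion (base $\tau$, digit set $\mathcal{D}$) of each element of $\mathbb{Z}[\tau]$ is optimal.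
   Context: Voronoi cell: $V=\{z\in\mathbb{C}:\ |z|\le|z-y|\text{ for all }y\in\mathbb{Z}[\tau]\}$. Writing $\{x\}$ for the fractional part and $r=\{\mathrm{Re}\,\tau\}$, $t=\mathrm{Im}\,\tau$, its vertices, in cyclic order, are $v_0=\frac12+\frac{i}{2t}(t^2+r^2-r)$, $v_1=r-\frac12+\frac{i}{2t}(t^2-r^2+r)$, $v_2=v_0-1$, $v_3=-v_0$, $v_4=-v_1$, $v_5=-v_2$; if $\mathrm{Re}\,\tau\in\mathbb{Z}$ then $v_1=v_2$ and $v_4=v_5$ and $V$ is a rectangle. Let $m\in\{4,6\}$ be the number of distinct vertices and relabel the distinct vertices in this order as $v_0,\dots,v_{m-1}$ (indices modulo $m$); let $v_{k+1/2}$ be the midpoint of the segment from $v_k$ to $v_{k+1}$. The restricted Voronoi cell $\widetilde V$ consists of the interior of $V$, the open segments from $v_{k+1/2}$ to $v_{k+1}$ (both endpoints excluded) for all $k$, the points $v_{k+1/2}$ for $k\in\{0,\dots,\lfloor m/2\rfloor-1\}$, and the points $v_k$ for $k\in\{1,\dots,\lfloor m/3\rfloor\}$. Minimal norm representatives digit set modulo $\tau^w$: the set $\mathcal{D}\subseteq\mathbb{Z}[\tau]$ consisting of $0$ and of exactly one representative of each residue class of $\mathbb{Z}[\tau]$ modulo $\tau^w$ that is not divisible by $\tau$, namely the one lying in $\tau^w\widetilde V$. A multi-expansion of $z\in\mathbb{Z}[\tau]$ is a finite multiset of pairs $(d,n)\in(\mathcal{D}\setminus\{0\})\times\mathbb{N}_0$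 with $\sum d\,\tau^n=z$; its weight is its cardinality counted with multiplicity. An expansion is a multi-expansion in which the exponents $n$ are pairwise distinct, identified with a finitely supported sequence $(\eta_n)_{n\in\mathbb{N}_0}\in\mathcal{D}^{\mathbb{N}_0}$ with $\sum_n\eta_n\tau^n=z$. A $w$-NAF-expansion is an expansion such that every block of $w$ consecutive digits $\eta_{j+w-1}\ldots\eta_j$ contains at most one non-zero digit. With this digit set, every element of $\mathbb{Z}[\tau]$ has exactly one $w$-NAF-expansion (a known theorem). An expansion of $z$ is optimal if its weight is at most the weight of every multi-expansion of $z$. *)

theory Defs
  imports "HOL-Analysis.Analysis" "HOL-Library.Multiset" "HOL-Computational_Algebra.Polynomial"
begin

definition int_adjoin :: "complex \<Rightarrow> complex set" where
  "int_adjoin \<tau> = range (\<lambda>f :: int poly. poly (map_poly of_int f) \<tau>)"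

definition voronoi_cell :: "complex \<Rightarrow> complex set" where
  "voronoi_cell \<tau> = {z. \<forall>y \<in> int_adjoin \<tau>. norm z \<le> norm (z - y)}"

text \<open>The explicit vertices are those of the cell of the lattice spanned by \<open>1\<close> and \<open>\<tau>\<close>, for the
  quadratic integers \<open>\<tau>\<close> considered here. They run counterclockwise if \<open>Im \<tau> > 0\<close> and
  clockwise if \<open>Im \<tau> < 0\<close>. If \<open>Re \<tau>\<close> is an integer, the second and third entries coincide, and
  so do the last two; \<open>remdups\<close> then leaves the four corners of a rectangle in cyclic order.\<close>

definition voronoi_vertices :: "complex \<Rightarrow> complex list" where
  "voronoi_vertices \<tau> =
    (let r = frac (Re \<tau>); t = Im \<tau>;
         v0 = Complex (1/2) ((t^2 + r^2 - r) / (2 * t));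
         v1 = Complex (r - 1/2) ((t^2 - r^2 + r) / (2 * t));
         v2 = v0 - 1
     in remdups [v0, v1, v2, - v0, - v1, - v2])"

definition vertex :: "complex \<Rightarrow> nat \<Rightarrow> complex" where
  "vertex \<tau> k = voronoi_vertices \<tau> ! (k mod length (voronoi_vertices \<tau>))"

definition edge_midpoint :: "complex \<Rightarrow> nat \<Rightarrow> complex" where
  "edge_midpoint \<tau> k = midpoint (vertex \<tau> k) (vertex \<tau> (k + 1))"

definition restricted_voronoi_cell :: "complex \<Rightarrow> complex set" where
  "restricted_voronoi_cell \<tau> =
    (let m = length (voronoi_vertices \<tau>)
     in interior (voronoi_cell \<tau>)
        \<union> (\<Union>k<m. open_segment (edge_midpoint \<tau> k) (vertex \<tau> (k + 1)))
        \<union> edge_midpoint \<tau> ` {..<m div 2}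
        \<union> vertex \<tau> ` {1..m div 3})"

text \<open>Minimal norm representatives digit set modulo \<open>\<tau> ^ w\<close>. The translates of
  \<open>\<tau> ^ w * restricted_voronoi_cell \<tau>\<close> by multiples of \<open>\<tau> ^ w\<close> tile the plane, so the
  elements of the lattice lying in that region are exactly one representative per residue class
  modulo \<open>\<tau> ^ w\<close>; divisibility by \<open>\<tau>\<close> (in \<open>int_adjoin \<tau>\<close>) depends only on the class.\<close>

definition mnr_digit_set :: "complex \<Rightarrow> nat \<Rightarrow> complex set" where
  "mnr_digit_set \<tau> w = insert 0
    {d \<in> int_adjoin \<tau>. (\<nexists>y. y \<in> int_adjoin \<tau> \<and> d = \<tau> * y)
       \<and> d \<in> (\<lambda>z. \<tau> ^ w * z) ` restricted_voronoi_cell \<tau>}"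

definition multi_expansion ::
  "complex set \<Rightarrow> complex \<Rightarrow> complex \<Rightarrow> (complex \<times> nat) multiset \<Rightarrow> bool" where
  "multi_expansion D \<tau> z M \<longleftrightarrow>
    set_mset M \<subseteq> (D - {0}) \<times> UNIV \<and> (\<Sum>(d, n) \<in># M. d * \<tau> ^ n) = z"

definition digit_support :: "(nat \<Rightarrow> complex) \<Rightarrow> nat set" where
  "digit_support \<eta> = {n. \<eta> n \<noteq> 0}"

definition weight :: "(nat \<Rightarrow> complex) \<Rightarrow> nat" where
  "weight \<eta> = card (digit_support \<eta>)"

definition expansion :: "complex set \<Rightarrow> complex \<Rightarrow> complex \<Rightarrow> (nat \<Rightarrow> complex) \<Rightarrow> bool" where
  "expansion D \<tau> z \<eta> \<longleftrightarrow>
    (\<forall>n. \<eta> n \<in> D) \<and> finite (digit_support \<eta>) \<and> (\<Sum>n \<in> digit_support \<eta>. \<eta> n * \<tau> ^ n) = z"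

text \<open>The multi-expansion with which a digit sequence is identified.\<close>

lemma expansion_imp_multi_expansion:
  assumes "expansion D \<tau> z \<eta>"
  defines "M \<equiv> image_mset (\<lambda>n. (\<eta> n, n)) (mset_set (digit_support \<eta>))"
  shows "multi_expansion D \<tau> z M" and "size M = weight \<eta>"
  using assms
  by (auto simp: expansion_def multi_expansion_def weight_def digit_support_def M_def
      multiset.map_comp o_def sum_unfold_sum_mset)

definition wnaf_expansion ::
  "nat \<Rightarrow> complex set \<Rightarrow> complex \<Rightarrow> complex \<Rightarrow> (nat \<Rightarrow> complex) \<Rightarrow> bool" where
  "wnaf_expansion w D \<tau> z \<eta> \<longleftrightarrow>
    expansion D \<tau> z \<eta> \<and> (\<forall>j. card {n \<in> {j..<j + w}. \<eta> n \<noteq> 0} \<le> 1)"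

definition optimal_expansion :: "complex set \<Rightarrow> complex \<Rightarrow> complex \<Rightarrow> (nat \<Rightarrow> complex) \<Rightarrow> bool" where
  "optimal_expansion D \<tau> z \<eta> \<longleftrightarrow>
    expansion D \<tau> z \<eta> \<and> (\<forall>M. multi_expansion D \<tau> z M \<longrightarrow> weight \<eta> \<le> size M)"

end

theory Submission
  imports Defs
begin

text \<open>
  Let \<open>L\<close> be the lattice \<open>\<int>[\<tau>]\<close>, let \<open>V\<close> be its Voronoi cell and \<open>R\<close> the circumradius of \<open>V\<close>.
  The shortest non-zero vectors of \<open>L\<close> have length \<open>1\<close>, so \<open>V\<close> contains the disc of radius \<open>1/2\<close>.
  All five conditions say, or imply, one inequality between norms,
  \<open>(\<bar>\<tau>\<bar> ^ (w - 1) + 2) * 2 R < \<bar>\<tau>\<bar> ^ w\<close>, and this inequality is all that the proof needs.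

  Digits have norm at most \<open>\<bar>\<tau>\<bar> ^ w R\<close>. A non-zero sum \<open>u = d + c \<tau> ^ k\<close> of two digit terms with
  \<open>k < w\<close> is \<open>\<tau> ^ l\<close> times an element of the form \<open>e + \<tau> ^ w y\<close>, where \<open>e\<close> is the digit of its
  residue class. The inequality gives \<open>y\<close> a norm below \<open>\<bar>\<tau>\<bar> ^ w / 2\<close>; lattice points of that size are
  zero or a power of \<open>\<tau>\<close> times a digit. So \<open>u\<close> is a sum of at most two digit terms, at most one of
  which has an exponent below \<open>w\<close> (\<open>few_summands\<close>). Rewriting pairs of
  low terms in this way never increases the weight of a multi-expansion, and it ends in a
  \<open>w\<close>-NAF (\<open>wnaf_not_heavier\<close>). Hence every multi-expansion of \<open>z\<close> is at least as heavy as some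
  \<open>w\<close>-NAF-expansion of \<open>z\<close>, and there is only one of those (\<open>wnaf_unique\<close>), because the digits
  are distinct modulo \<open>\<tau> ^ w\<close>. By the same inequality, division by \<open>\<tau> ^ w\<close> with remainder in the
  digit set lowers all norms of at least \<open>\<bar>\<tau>\<bar> ^ w / 2\<close>, so every lattice point has a multi-expansion
  (\<open>multi_expansion_exists\<close>).

  That each residue class has exactly one digit means that the restricted Voronoi cell is a
  fundamental domain of \<open>L\<close>, down to its boundary points
  (\<open>restricted_cell_representative\<close>, \<open>restricted_cell_unique\<close>). In the coordinates
  \<open>Re z\<close> and \<open>\<langle>z, \<theta>\<rangle>\<close>, where \<open>\<theta>\<close> is the translate of \<open>\<tau>\<close> with \<open>0 \<le> Re \<theta> < 1\<close>, the edges of the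
  cell lie on lines where one of \<open>\<langle>z, 1\<rangle>\<close>, \<open>\<langle>z, \<theta>\<rangle>\<close>, \<open>\<langle>z, \<theta> - 1\<rangle>\<close> is constant, and the claim
  becomes linear arithmetic. The rectangle is the case where two opposite edges of the hexagon
  have length zero, so both shapes are treated together.
\<close>

section \<open>Half-open hexagons in linear coordinates\<close>

text \<open>On a line where one of two joint coordinates is constant, an open segment is an open
  interval of the other coordinate. Every edge of the Voronoi cell lies on such a line.\<close>

lemma open_segment_coordinates:
  fixes f g :: "'a::real_vector \<Rightarrow> real"
  assumes f: "linear f" and g: "linear g"
    and inj: "\<And>x. f x = 0 \<Longrightarrow> g x = 0 \<Longrightarrow> x = 0"
    and ab: "g a = c" "g b = c" "f a \<le> f b"
  shows "x \<in> open_segment a b \<longleftrightarrow> g x = c \<and> f a < f x \<and> f x < f b"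
proof
  assume "x \<in> open_segment a b"
  then obtain u where ne: "a \<noteq> b" and u: "0 < u" "u < 1" and x: "x = (1 - u) *\<^sub>R a + u *\<^sub>R b"
    by (auto simp: in_segment)
  have "f a \<noteq> f b"
    using inj[of "a - b"] ne ab linear_diff[OF f] linear_diff[OF g] by auto
  with ab have lt: "f a < f b" by simp
  have fx: "f x = f a + u * (f b - f a)" and gx: "g x = c"
    unfolding x linear_add[OF f] linear_add[OF g] linear_scale[OF f] linear_scale[OF g]
    using ab by (simp_all add: algebra_simps)
  have "u * (f b - f a) < 1 * (f b - f a)" "0 < u * (f b - f a)"
    using u lt by (auto intro: mult_strict_right_mono)
  then show "g x = c \<and> f a < f x \<and> f x < f b"
    using fx gx by simp
next
  assume h: "g x = c \<and> f a < f x \<and> f x < f b"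
  define u where "u = (f x - f a) / (f b - f a)"
  have u: "0 < u" "u < 1" and uf: "u * (f b - f a) = f x - f a"
    using h by (auto simp: u_def)
  have "x - ((1 - u) *\<^sub>R a + u *\<^sub>R b) = 0"
  proof (rule inj)
    show "f (x - ((1 - u) *\<^sub>R a + u *\<^sub>R b)) = 0"
      unfolding linear_add[OF f] linear_diff[OF f] linear_scale[OF f]
      using uf by (simp add: algebra_simps)
    show "g (x - ((1 - u) *\<^sub>R a + u *\<^sub>R b)) = 0"
      unfolding linear_add[OF g] linear_diff[OF g] linear_scale[OF g]
      using h ab by (simp add: algebra_simps)
  qed
  then show "x \<in> open_segment a b"
    using u h by (auto simp: in_segment)
qed

text \<open>The inequality \<open>2 \<langle>z, y\<rangle> \<le> \<bar>y\<bar>\<^sup>2\<close> for \<open>y = i u + j v\<close>, given that it holds for \<open>u\<close> and \<open>v\<close>; here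
  \<open>U\<close>, \<open>V\<close> are \<open>\<langle>z, u\<rangle>\<close>, \<open>\<langle>z, v\<rangle>\<close> and \<open>K\<close>, \<open>L\<close>, \<open>g\<close> are \<open>\<bar>u\<bar>\<^sup>2\<close>, \<open>\<bar>v\<bar>\<^sup>2\<close>, \<open>\<langle>u, v\<rangle>\<close>. The excess is at least
  \<open>i (i - 1) K + 2 i j g + j (j - 1) L\<close>, a sum of non-negative terms; hence the description of
  equality.\<close>

lemma acute_sector:
  fixes i j :: int and U V K L g :: real
  assumes ij: "0 \<le> i" "0 \<le> j" and K: "0 < K" and L: "0 < L" and g: "0 \<le> g"
    and U: "2 * U \<le> K" and V: "2 * V \<le> L"
  shows "2 * (i * U + j * V) \<le> i\<^sup>2 * K + 2 * real_of_int i * j * g + j\<^sup>2 * L"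
    and "2 * (i * U + j * V) = i\<^sup>2 * K + 2 * real_of_int i * j * g + j\<^sup>2 * L \<Longrightarrow>
      i \<in> {0,1} \<and> j \<in> {0,1} \<and> (i = 0 \<or> j = 0 \<or> g = 0)"
proof -
  have *: "0 \<le> i * (i - 1)" if "0 \<le> i" for i :: int
    using that by (cases "i = 0") auto
  have i: "0 \<le> real_of_int (i * (i - 1)) * K" and j: "0 \<le> real_of_int (j * (j - 1)) * L"
    and ijg: "0 \<le> 2 * real_of_int i * j * g"
    using * ij K L g by (simp_all only: of_int_0_le_iff zero_le_mult_iff) auto
  have "i * (2 * U) \<le> i * K" "j * (2 * V) \<le> j * L"
    using ij U V by (auto intro: mult_left_mono)
  then have sum: "real_of_int (i * (i - 1)) * K + 2 * real_of_int i * j * g + real_of_int (j * (j - 1)) * L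
      \<le> i\<^sup>2 * K + 2 * real_of_int i * j * g + j\<^sup>2 * L - 2 * (i * U + j * V)"
    by (simp add: algebra_simps power2_eq_square)
  show "2 * (i * U + j * V) \<le> i\<^sup>2 * K + 2 * real_of_int i * j * g + j\<^sup>2 * L"
    using sum i j ijg by linarith
  assume "2 * (i * U + j * V) = i\<^sup>2 * K + 2 * real_of_int i * j * g + j\<^sup>2 * L"
  then have "real_of_int (i * (i - 1)) * K = 0" "real_of_int (j * (j - 1)) * L = 0"
    "2 * real_of_int i * j * g = 0"
    using sum i j ijg by linarith+
  then show "i \<in> {0,1} \<and> j \<in> {0,1} \<and> (i = 0 \<or> j = 0 \<or> g = 0)"
    using K L by auto
qed

text \<open>A point \<open>z\<close> is given by \<open>a = \<langle>z, 1\<rangle>\<close> and \<open>b = \<langle>z, \<theta>\<rangle>\<close>, where \<open>r = Re \<theta>\<close> and \<open>2 \<beta> = \<bar>\<theta>\<bar>\<^sup>2\<close>. The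
  bounds are half the squared lengths of \<open>1\<close>, \<open>\<theta>\<close> and \<open>\<theta> - 1\<close>: the conditions say that \<open>z\<close> is no
  closer to any of these vectors or their negatives than to \<open>0\<close>.\<close>

definition closed_hexagon :: "real \<Rightarrow> real \<Rightarrow> real \<Rightarrow> real \<Rightarrow> bool" where
  "closed_hexagon r \<beta> a b \<longleftrightarrow> \<bar>a\<bar> \<le> 1/2 \<and> \<bar>b\<bar> \<le> \<beta> \<and> \<bar>b - a\<bar> \<le> \<beta> + 1/2 - r"

definition open_hexagon :: "real \<Rightarrow> real \<Rightarrow> real \<Rightarrow> real \<Rightarrow> bool" where
  "open_hexagon r \<beta> a b \<longleftrightarrow> \<bar>a\<bar> < 1/2 \<and> \<bar>b\<bar> < \<beta> \<and> \<bar>b - a\<bar> < \<beta> + 1/2 - r"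

text \<open>The edges in cyclic order, each cut down to the half next to its end vertex. The first three
  half edges contain the midpoint, and the first two also contain the end vertex.\<close>

definition restricted_boundary :: "real \<Rightarrow> real \<Rightarrow> real \<Rightarrow> real \<Rightarrow> bool" where
  "restricted_boundary r \<beta> a b \<longleftrightarrow>
     (b = \<beta> \<and> r - 1/2 \<le> a \<and> a \<le> r/2)
   \<or> (b - a = \<beta> + 1/2 - r \<and> - 1/2 \<le> a \<and> a \<le> (r - 1)/2)
   \<or> (a = - 1/2 \<and> - \<beta> < b \<and> b \<le> - r/2)
   \<or> (b = - \<beta> \<and> - r/2 < a \<and> a < 1/2 - r)
   \<or> (b - a = - (\<beta> + 1/2 - r) \<and> (1 - r)/2 < a \<and> a < 1/2)
   \<or> (a = 1/2 \<and> r/2 < b \<and> b < \<beta>)"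

text \<open>The six vectors \<open>1\<close>, \<open>\<theta>\<close>, \<open>\<theta> - 1\<close> and their negatives divide the lattice into six sectors, each
  generated by two neighbours that enclose an angle of at most 90 degrees. Three sectors cover the
  upper half plane, and the others follow by symmetry.\<close>

lemma form_le_norm_upper_half:
  fixes m n :: int and r \<beta> a b :: real
  assumes r: "0 \<le> r" "r < 1" "r < 2 * \<beta>" and h: "closed_hexagon r \<beta> a b" and n: "0 \<le> n"
  shows "2 * (m * a + n * b) \<le> m\<^sup>2 + 2 * real_of_int m * n * r + 2 * \<beta> * n\<^sup>2 \<and>
    (2 * (m * a + n * b) = m\<^sup>2 + 2 * real_of_int m * n * r + 2 * \<beta> * n\<^sup>2 \<longrightarrow>
      (m, n) \<in> {(0,0), (1,0), (-1,0), (0,1), (-1,1)} \<or> (m, n) = (1,1) \<and> r = 0)"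
proof -
  have b: "0 < 2 * \<beta>" "0 < 2 * (\<beta> + 1/2 - r)" using r by (simp_all add: field_simps)
  have h': "2 * a \<le> 1" "2 * (- a) \<le> 1" "2 * b \<le> 2 * \<beta>" "2 * (b - a) \<le> 2 * (\<beta> + 1/2 - r)"
    using h by (auto simp: closed_hexagon_def abs_le_iff)
  consider "0 \<le> m" | "m \<le> 0" "0 \<le> n + m" | "n + m \<le> 0" "m \<le> 0" using n by linarith
  then show ?thesis
  proof cases
    case 1
    have e: "m\<^sup>2 * (1::real) + 2 * real_of_int m * n * r + n\<^sup>2 * (2 * \<beta>)
        = m\<^sup>2 + 2 * real_of_int m * n * r + 2 * \<beta> * n\<^sup>2"
      by simp
    show ?thesis
      using acute_sector[OF 1 n _ b(1) r(1) h'(1,3), unfolded e] by auto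
  next
    case 2
    have e: "(- m)\<^sup>2 * (2 * (\<beta> + 1/2 - r)) + 2 * real_of_int (- m) * (n + m) * (2 * \<beta> - r)
        + (n + m)\<^sup>2 * (2 * \<beta>) = m\<^sup>2 + 2 * real_of_int m * n * r + 2 * \<beta> * n\<^sup>2"
      "2 * ((- m) * (b - a) + (n + m) * b) = 2 * (m * a + n * b)"
      by (auto simp: algebra_simps power2_eq_square)
    have "0 \<le> - m" "0 \<le> 2 * \<beta> - r" using 2 r by auto
    note sector = acute_sector[OF this(1) 2(2) b(2,1) this(2) h'(4,3), unfolded e]
    have "(m, n) \<in> {(0,0), (0,1), (-1,1)}"
      if "- m \<in> {0,1} \<and> n + m \<in> {0,1} \<and> (- m = 0 \<or> n + m = 0 \<or> 2 * \<beta> - r = 0)"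
      using that r by (auto; presburger)
    with sector show ?thesis by blast
  next
    case 3
    have e: "n\<^sup>2 * (2 * (\<beta> + 1/2 - r)) + 2 * real_of_int n * (- n - m) * (1 - r)
        + (- n - m)\<^sup>2 * (1::real) = m\<^sup>2 + 2 * real_of_int m * n * r + 2 * \<beta> * n\<^sup>2"
      "2 * (n * (b - a) + (- n - m) * - a) = 2 * (m * a + n * b)"
      by (auto simp: algebra_simps power2_eq_square)
    have "0 \<le> - n - m" "0 \<le> 1 - r" using 3 r by auto
    note sector = acute_sector[OF n this(1) b(2) zero_less_one this(2) h'(4,2), unfolded e]
    have "(m, n) \<in> {(0,0), (-1,0), (-1,1)}"
      if "n \<in> {0,1} \<and> - n - m \<in> {0,1} \<and> (n = 0 \<or> - n - m = 0 \<or> 1 - r = 0)"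
      using that r by (auto; presburger)
    with sector show ?thesis by blast
  qed
qed

text \<open>This is \<open>2 \<langle>z, y\<rangle> \<le> \<bar>y\<bar>\<^sup>2\<close> for \<open>y = m + n \<theta>\<close>. Equality means that \<open>z\<close> is as far from \<open>y\<close> as from
  \<open>0\<close>, so the cells around these two points touch. The points \<open>1 + \<theta>\<close> and
  \<open>- 1 - \<theta>\<close> occur only for a rectangular cell, which touches eight others.\<close>

lemma form_le_norm:
  fixes m n :: int and r \<beta> a b :: real
  assumes r: "0 \<le> r" "r < 1" "r < 2 * \<beta>" and h: "closed_hexagon r \<beta> a b"
  shows "2 * (m * a + n * b) \<le> m\<^sup>2 + 2 * real_of_int m * n * r + 2 * \<beta> * n\<^sup>2"
    and "2 * (m * a + n * b) = m\<^sup>2 + 2 * real_of_int m * n * r + 2 * \<beta> * n\<^sup>2 \<Longrightarrow>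
      (m, n) \<in> {(0,0), (1,0), (-1,0), (0,1), (0,-1), (1,-1), (-1,1)}
      \<or> (m, n) \<in> {(1,1), (-1,-1)} \<and> r = 0"
proof -
  have h': "closed_hexagon r \<beta> (- a) (- b)" using h by (auto simp: closed_hexagon_def)
  have "2 * (m * a + n * b) \<le> m\<^sup>2 + 2 * real_of_int m * n * r + 2 * \<beta> * n\<^sup>2 \<and>
    (2 * (m * a + n * b) = m\<^sup>2 + 2 * real_of_int m * n * r + 2 * \<beta> * n\<^sup>2 \<longrightarrow>
      (m, n) \<in> {(0,0), (1,0), (-1,0), (0,1), (0,-1), (1,-1), (-1,1)}
      \<or> (m, n) \<in> {(1,1), (-1,-1)} \<and> r = 0)"
  proof (cases "0 \<le> n")
    case True
    show ?thesis using form_le_norm_upper_half[OF r h True, of m] by auto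
  next
    case False
    show ?thesis using form_le_norm_upper_half[OF r h', of "- n" "- m"] False
      by (auto simp: minus_equation_iff)
  qed
  then show "2 * (m * a + n * b) \<le> m\<^sup>2 + 2 * real_of_int m * n * r + 2 * \<beta> * n\<^sup>2"
    and "2 * (m * a + n * b) = m\<^sup>2 + 2 * real_of_int m * n * r + 2 * \<beta> * n\<^sup>2 \<Longrightarrow>
      (m, n) \<in> {(0,0), (1,0), (-1,0), (0,1), (0,-1), (1,-1), (-1,1)}
      \<or> (m, n) \<in> {(1,1), (-1,-1)} \<and> r = 0" by blast+
qed

lemma restricted_boundary_imp_closed:
  assumes r: "0 \<le> r" "r < 1" "r < 2 * \<beta>" and "restricted_boundary r \<beta> a b"
  shows "closed_hexagon r \<beta> a b"
  using assms unfolding restricted_boundary_def closed_hexagon_def abs_le_iff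
  by (elim disjE conjE) (auto simp: field_simps)

text \<open>Translations by lattice vectors pair each edge with the opposite one and permute the vertices in
  two classes; the chosen half edges, midpoints and vertices meet every class.\<close>

lemma boundary_translate:
  fixes r \<beta> a b :: real
  assumes r: "0 \<le> r" "r < 1" "r < 2 * \<beta>" and c: "closed_hexagon r \<beta> a b"
    and no: "\<not> open_hexagon r \<beta> a b"
  obtains m n :: int where "restricted_boundary r \<beta> (a - (m + n * r)) (b - (m * r + 2 * \<beta> * n))"
proof -
  let ?R = "\<lambda>(m::int) (n::int). restricted_boundary r \<beta> (a - (m + n * r)) (b - (m * r + 2 * \<beta> * n))"
  have c': "- 1/2 \<le> a" "a \<le> 1/2" "- \<beta> \<le> b" "b \<le> \<beta>" "b - a \<le> \<beta> + 1/2 - r"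
    "- (\<beta> + 1/2 - r) \<le> b - a"
    using c by (auto simp: closed_hexagon_def)
  have "a = 1/2 \<or> a = - 1/2 \<or> b = \<beta> \<or> b = - \<beta> \<or> b - a = \<beta> + 1/2 - r \<or> b - a = - (\<beta> + 1/2 - r)"
    using c' no by (auto simp: open_hexagon_def abs_less_iff)
  moreover
  \<comment> \<open>For each edge: a point of the excluded half moves to the opposite edge, an excluded vertex to
    an end vertex of one of the first two edges.\<close>
  have "?R 0 0 \<or> ?R 1 0 \<or> ?R 1 (-1)" if "a = 1/2"
    using that r c' unfolding restricted_boundary_def by (auto simp: field_simps)
  moreover have "?R 0 0 \<or> ?R (-1) 0 \<or> ?R 0 (-1)" if "a = - 1/2"
    using that r c' unfolding restricted_boundary_def by (auto simp: field_simps)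
  moreover have "?R 0 0 \<or> ?R 0 1 \<or> ?R 1 0" if "b = \<beta>"
    using that r c' unfolding restricted_boundary_def by (auto simp: field_simps)
  moreover have "?R 0 0 \<or> ?R 0 (-1) \<or> ?R 1 (-1)" if "b = - \<beta>"
    using that r c' unfolding restricted_boundary_def by (auto simp: field_simps)
  moreover have "?R 0 0 \<or> ?R (-1) 1 \<or> ?R 0 1" if "b - a = \<beta> + 1/2 - r"
    using that r c' unfolding restricted_boundary_def by (auto simp: field_simps)
  moreover have "?R 0 0 \<or> ?R 1 (-1) \<or> ?R 1 0" if "b - a = - (\<beta> + 1/2 - r)"
    using that r c' unfolding restricted_boundary_def by (auto simp: field_simps)
  ultimately show ?thesis using that by blast
qed

text \<open>No two of the chosen boundary points differ by a lattice vector. Only the neighbours of \<open>0\<close> matter,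
  and one of \<open>y\<close> and \<open>- y\<close> suffices.\<close>

lemma boundary_unique:
  fixes m n :: int and r \<beta> a b a' b' :: real
  assumes r: "0 \<le> r" "r < 1" "r < 2 * \<beta>"
    and b1: "restricted_boundary r \<beta> a b" and b2: "restricted_boundary r \<beta> a' b'"
    and d: "a - a' = m + n * r" "b - b' = m * r + 2 * \<beta> * n"
    and mn: "(m, n) \<in> {(1,0), (0,1), (-1,1)} \<or> (m, n) = (1,1) \<and> r = 0"
  shows False
proof -
  have "closed_hexagon r \<beta> a b" "closed_hexagon r \<beta> a' b'"
    using restricted_boundary_imp_closed r b1 b2 by auto
  then have c: "- 1/2 \<le> a" "a \<le> 1/2" "- \<beta> \<le> b" "b \<le> \<beta>" "b - a \<le> \<beta> + 1/2 - r"
    "- (\<beta> + 1/2 - r) \<le> b - a"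
    "- 1/2 \<le> a'" "a' \<le> 1/2" "- \<beta> \<le> b'" "b' \<le> \<beta>" "b' - a' \<le> \<beta> + 1/2 - r"
    "- (\<beta> + 1/2 - r) \<le> b' - a'"
    by (auto simp: closed_hexagon_def)
  consider "m = 1" "n = 0" | "m = 0" "n = 1" | "m = -1" "n = 1" | "m = 1" "n = 1" "r = 0"
    using mn by auto
  then show False
  proof cases
    case 1
    then have e: "a = 1/2" "a' = - 1/2" "b' = b - r" using c d by auto
    show ?thesis using b1 b2 r unfolding restricted_boundary_def e by auto
  next
    case 2
    then have e: "b = \<beta>" "b' = - \<beta>" "a' = a - r" using c d by auto
    show ?thesis using b1 b2 r unfolding restricted_boundary_def e by auto
  next
    case 3
    then have "b - a = \<beta> + 1/2 - r" "b' - a' = - (\<beta> + 1/2 - r)" "a' = a + 1 - r" using c d by auto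
    then have e: "b = a + \<beta> + 1/2 - r" "b' = a + 1/2 - \<beta>" "a' = a + 1 - r" by auto
    show ?thesis using b1 b2 r unfolding restricted_boundary_def e by auto
  next
    case 4
    then have e: "a = 1/2" "a' = - 1/2" "b = \<beta>" "b' = - \<beta>" using c d by auto
    show ?thesis using b1 b2 r unfolding restricted_boundary_def e by auto
  qed
qed

section \<open>The restricted Voronoi cell is a fundamental domain\<close>

text \<open>The last condition reads \<open>\<langle>\<theta>, \<theta> - 1\<rangle> > 0\<close> for the translate \<open>\<theta>\<close> of \<open>\<tau>\<close> with real part in
  \<open>{0..<1}\<close>: the triangle \<open>0\<close>, \<open>1\<close>, \<open>\<theta>\<close> has no obtuse angle, so \<open>1\<close>, \<open>\<theta>\<close> and \<open>\<theta> - 1\<close> determine the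
  Voronoi cell.\<close>

locale reduced_lattice =
  fixes \<tau> :: complex
  assumes adjoin: "int_adjoin \<tau> = {of_int m + of_int n * \<tau> | m n. True}"
    and acute: "frac (Re \<tau>) * (1 - frac (Re \<tau>)) < (Im \<tau>)\<^sup>2"
begin

definition r :: real where "r = frac (Re \<tau>)"
definition \<beta> :: real where "\<beta> = (r\<^sup>2 + (Im \<tau>)\<^sup>2) / 2"

text \<open>The inner product with \<open>\<theta>\<close>, whose imaginary part is that of \<open>\<tau>\<close>.\<close>

definition form :: "complex \<Rightarrow> real" where "form z = r * Re z + Im \<tau> * Im z"

lemma double_\<beta>: "2 * \<beta> = r\<^sup>2 + (Im \<tau>)\<^sup>2"
  by (simp add: \<beta>_def)

lemma r_bounds: "0 \<le> r" "r < 1" "r < 2 * \<beta>"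
  and Im_nonzero: "Im \<tau> \<noteq> 0"
proof -
  show r: "0 \<le> r" "r < 1" by (simp_all add: r_def frac_lt_1)
  show "r < 2 * \<beta>" using acute by (simp add: r_def[symmetric] \<beta>_def algebra_simps power2_eq_square)
  have "0 \<le> r * (1 - r)" using r by simp
  then show "Im \<tau> \<noteq> 0" using acute by (auto simp: r_def)
qed

lemma linear_form: "linear form"
  by (auto intro!: linearI simp: form_def algebra_simps)

lemma coordinates_inject: "Re x = Re y \<Longrightarrow> form x = form y \<Longrightarrow> x = y"
  using Im_nonzero by (simp add: form_def complex_eq_iff)

lemma adjoin_coordinates:
  "y \<in> int_adjoin \<tau> \<longleftrightarrow> (\<exists>(m::int) (n::int). Re y = m + n * r \<and> form y = m * r + 2 * \<beta> * n)"
proof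
  assume "y \<in> int_adjoin \<tau>"
  then obtain m n :: int where y: "y = of_int m + of_int n * \<tau>" by (auto simp: adjoin)
  have "Re y = of_int (m + n * \<lfloor>Re \<tau>\<rfloor>) + n * r"
    by (simp add: y r_def frac_def algebra_simps)
  moreover from this have "form y = of_int (m + n * \<lfloor>Re \<tau>\<rfloor>) * r + 2 * \<beta> * n"
    unfolding double_\<beta> by (simp add: form_def y algebra_simps power2_eq_square)
  ultimately show "\<exists>(m::int) (n::int). Re y = m + n * r \<and> form y = m * r + 2 * \<beta> * n" by blast
next
  assume "\<exists>(m::int) (n::int). Re y = m + n * r \<and> form y = m * r + 2 * \<beta> * n"
  then obtain m n :: int where mn: "Re y = m + n * r" "form y = m * r + 2 * \<beta> * n" by blast
  have "y = of_int (m - n * \<lfloor>Re \<tau>\<rfloor>) + of_int n * \<tau>"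
    by (rule coordinates_inject, unfold mn double_\<beta>)
      (simp_all add: form_def r_def frac_def algebra_simps power2_eq_square)
  then show "y \<in> int_adjoin \<tau>" unfolding adjoin by blast
qed

lemma norm_le_translate_iff:
  fixes m n :: int
  assumes "Re y = m + n * r" "form y = m * r + 2 * \<beta> * n"
  shows "norm z \<le> norm (z - y) \<longleftrightarrow>
    2 * (m * Re z + n * form z) \<le> m\<^sup>2 + 2 * real_of_int m * n * r + 2 * \<beta> * n\<^sup>2"
proof -
  have Im: "Im y = n * Im \<tau>"
  proof -
    have "Im \<tau> * Im y = Im \<tau> * (n * Im \<tau>)"
      using assms unfolding double_\<beta> by (simp add: form_def algebra_simps power2_eq_square)
    then show ?thesis using Im_nonzero by simp
  qed
  have "norm z \<le> norm (z - y) \<longleftrightarrow> (norm z)\<^sup>2 \<le> (norm (z - y))\<^sup>2"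
    by (simp add: abs_le_square_iff[symmetric])
  also have "\<dots> \<longleftrightarrow> 2 * (m * Re z + n * form z) \<le> m\<^sup>2 + 2 * real_of_int m * n * r + 2 * \<beta> * n\<^sup>2"
    unfolding cmod_power2 minus_complex.sel assms(1) Im
    unfolding double_\<beta> by (simp add: form_def algebra_simps power2_eq_square)
  finally show ?thesis .
qed

text \<open>The six neighbours already cut out the cell, by \<open>form_le_norm\<close>.\<close>

lemma voronoi_cell_iff: "z \<in> voronoi_cell \<tau> \<longleftrightarrow> closed_hexagon r \<beta> (Re z) (form z)"
proof
  assume z: "z \<in> voronoi_cell \<tau>"
  have *: "2 * (m * Re z + n * form z) \<le> m\<^sup>2 + 2 * real_of_int m * n * r + 2 * \<beta> * n\<^sup>2"
    for m n :: int
  proof -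
    define y where "y = of_int (m - n * \<lfloor>Re \<tau>\<rfloor>) + of_int n * \<tau>"
    have "y \<in> int_adjoin \<tau>" unfolding y_def adjoin by blast
    then have "norm z \<le> norm (z - y)" using z by (simp add: voronoi_cell_def)
    moreover have "Re y = m + n * r" "form y = m * r + 2 * \<beta> * n"
      unfolding double_\<beta>
      by (simp_all add: y_def form_def r_def frac_def algebra_simps power2_eq_square)
    ultimately show ?thesis using norm_le_translate_iff by blast
  qed
  show "closed_hexagon r \<beta> (Re z) (form z)"
    using *[of 1 0] *[of "-1" 0] *[of 0 1] *[of 0 "-1"] *[of 1 "-1"] *[of "-1" 1]
    by (auto simp: closed_hexagon_def abs_le_iff)
next
  assume "closed_hexagon r \<beta> (Re z) (form z)"
  from form_le_norm(1)[OF r_bounds this] show "z \<in> voronoi_cell \<tau>"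
    unfolding voronoi_cell_def Ball_def mem_Collect_eq adjoin_coordinates
    using norm_le_translate_iff by blast
qed

text \<open>An interior point can be pushed outwards from the origin within the cell, so it
  satisfies the inequalities strictly.\<close>

lemma interior_voronoi_cell_iff:
  "z \<in> interior (voronoi_cell \<tau>) \<longleftrightarrow> open_hexagon r \<beta> (Re z) (form z)"
proof
  assume "z \<in> interior (voronoi_cell \<tau>)"
  then obtain e where e: "0 < e" "cball z e \<subseteq> voronoi_cell \<tau>" by (auto simp: mem_interior_cball)
  \<comment> \<open>small enough that \<open>z\<close> moves by at most \<open>e\<close>\<close>
  define k where "k = 1 + e / (norm z + 1)"
  have k: "1 < k" using e by (simp add: k_def add_nonneg_pos)
  have "z - of_real k * z = of_real (1 - k) * z" by (simp add: algebra_simps)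
  then have "dist z (of_real k * z) = \<bar>1 - k\<bar> * norm z"
    by (simp only: dist_norm norm_mult norm_of_real)
  also have "\<dots> \<le> e"
  proof -
    have "e * (norm z / (norm z + 1)) \<le> e * 1"
      using e by (intro mult_left_mono) (auto simp: divide_le_eq add_nonneg_pos)
    then show ?thesis using e norm_ge_zero[of z] by (simp add: k_def)
  qed
  finally have "of_real k * z \<in> voronoi_cell \<tau>" using e by auto
  then have "closed_hexagon r \<beta> (k * Re z) (k * form z)"
    by (simp add: voronoi_cell_iff form_def algebra_simps)
  then have "k * \<bar>Re z\<bar> \<le> 1/2" "k * \<bar>form z\<bar> \<le> \<beta>" "k * \<bar>form z - Re z\<bar> \<le> \<beta> + 1/2 - r"
    using k by (simp_all add: closed_hexagon_def abs_mult flip: right_diff_distrib)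
  moreover have "x < c" if "k * x \<le> c" "0 < c" "0 \<le> x" for x c
    by (metis k less_le_trans mult_1 mult_strict_right_mono order_le_less that)
  moreover have "0 < \<beta>" "0 < \<beta> + 1/2 - r" using r_bounds by linarith+
  ultimately show "open_hexagon r \<beta> (Re z) (form z)" by (simp add: open_hexagon_def)
next
  assume z: "open_hexagon r \<beta> (Re z) (form z)"
  have "open {z. open_hexagon r \<beta> (Re z) (form z)}"
    unfolding open_hexagon_def form_def
    by (intro open_Collect_conj open_Collect_less continuous_intros)
  moreover have "{z. open_hexagon r \<beta> (Re z) (form z)} \<subseteq> voronoi_cell \<tau>"
    by (auto simp: voronoi_cell_iff open_hexagon_def closed_hexagon_def)
  ultimately show "z \<in> interior (voronoi_cell \<tau>)" using z interior_maximal by blast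
qed

definition v0 :: complex where
  "v0 = Complex (1/2) (((Im \<tau>)\<^sup>2 + r\<^sup>2 - r) / (2 * Im \<tau>))"
definition v1 :: complex where
  "v1 = Complex (r - 1/2) (((Im \<tau>)\<^sup>2 - r\<^sup>2 + r) / (2 * Im \<tau>))"

lemma vertex_coordinates: "Re v0 = 1/2" "Re v1 = r - 1/2" "form v0 = \<beta>" "form v1 = \<beta>"
  using Im_nonzero by (simp_all add: v0_def v1_def form_def \<beta>_def field_simps power2_eq_square)

lemma vertex_coordinates':
  "Re (v0 - 1) = - 1/2" "form (v0 - 1) = \<beta> - r" "Re (1 - v0) = 1/2" "form (1 - v0) = r - \<beta>"
  "Re (- v0) = - 1/2" "form (- v0) = - \<beta>" "Re (- v1) = 1/2 - r" "form (- v1) = - \<beta>"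
proof -
  have "form 1 = r" by (simp add: form_def)
  then show "form (v0 - 1) = \<beta> - r" "form (1 - v0) = r - \<beta>" "form (- v0) = - \<beta>" "form (- v1) = - \<beta>"
    by (simp_all add: linear_diff[OF linear_form] linear_neg[OF linear_form] vertex_coordinates)
qed (simp_all add: vertex_coordinates)

lemma voronoi_vertices_eq: "voronoi_vertices \<tau> = remdups [v0, v1, v0 - 1, - v0, - v1, - (v0 - 1)]"
  by (simp add: voronoi_vertices_def Let_def v0_def v1_def r_def)

text \<open>The boundary part of the restricted cell, read off the list of six vertices without removal of
  duplicates. In the rectangular case the edge from \<open>v1\<close> to \<open>v0 - 1\<close> is a single point: its open half
  is empty and its midpoint is a corner that is chosen anyway. So the same formula describes
  the rectangle.\<close>

definition half_open_boundary :: "complex set" where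
  "half_open_boundary =
     open_segment (midpoint v0 v1) v1 \<union> open_segment (midpoint v1 (v0 - 1)) (v0 - 1)
     \<union> open_segment (midpoint (v0 - 1) (- v0)) (- v0) \<union> open_segment (midpoint (- v0) (- v1)) (- v1)
     \<union> open_segment (midpoint (- v1) (1 - v0)) (1 - v0) \<union> open_segment (midpoint (1 - v0) v0) v0
     \<union> {midpoint v0 v1, midpoint v1 (v0 - 1), midpoint (v0 - 1) (- v0), v1, v0 - 1}"

lemma restricted_voronoi_cell_eq:
  "restricted_voronoi_cell \<tau> = interior (voronoi_cell \<tau>) \<union> half_open_boundary"
proof (cases "r = 0")
  case True
  have e: "v1 = v0 - 1"
    using True coordinates_inject[of v1 "v0 - 1"] by (simp only: vertex_coordinates vertex_coordinates')
  have "distinct (map (\<lambda>z. (Re z, form z)) [v0, v0 - 1, - v0, 1 - v0])"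
    unfolding list.map vertex_coordinates vertex_coordinates' using r_bounds by auto
  then have "distinct [v0, v0 - 1, - v0, 1 - v0]"
    unfolding distinct_map by blast
  moreover have "remdups [a, b, b, c, d, d] = [a, b, c, d]" if "distinct [a, b, c, d]"
    for a b c d :: complex using that by auto
  ultimately have l: "voronoi_vertices \<tau> = [v0, v0 - 1, - v0, 1 - v0]"
    unfolding voronoi_vertices_eq e minus_diff_eq by blast
  have len: "length (voronoi_vertices \<tau>) = 4" by (simp add: l)
  have v: "vertex \<tau> 0 = v0" "vertex \<tau> 1 = v0 - 1" "vertex \<tau> 2 = - v0" "vertex \<tau> 3 = 1 - v0" "vertex \<tau> 4 = v0"
    unfolding vertex_def len by (simp_all add: l)
  have "{..<length (voronoi_vertices \<tau>)} = {0,1,2,3}"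
    "{..<length (voronoi_vertices \<tau>) div 2} = {0,1}"
     "{1..length (voronoi_vertices \<tau>) div 3} = {1}"
    unfolding len by auto
  note ranges = this
  have succ: "0 + 1 = (1::nat)" "1 + 1 = (2::nat)" "2 + 1 = (3::nat)" "3 + 1 = (4::nat)" by simp_all
  show ?thesis
    unfolding restricted_voronoi_cell_def half_open_boundary_def Let_def ranges edge_midpoint_def e
      minus_diff_eq
      image_insert image_empty UN_insert UN_empty succ v midpoint_idem open_segment_idem
    by blast
next
  case False
  have "distinct (map (\<lambda>z. (Re z, form z)) [v0, v1, v0 - 1, - v0, - v1, 1 - v0])"
    unfolding list.map vertex_coordinates vertex_coordinates' using r_bounds False by auto
  then have "distinct [v0, v1, v0 - 1, - v0, - v1, 1 - v0]"
    unfolding distinct_map by blast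
  then have l: "voronoi_vertices \<tau> = [v0, v1, v0 - 1, - v0, - v1, 1 - v0]"
    unfolding voronoi_vertices_eq by (simp add: distinct_remdups_id del: remdups.simps)
  have len: "length (voronoi_vertices \<tau>) = 6" by (simp add: l)
  have v: "vertex \<tau> 0 = v0" "vertex \<tau> 1 = v1" "vertex \<tau> 2 = v0 - 1" "vertex \<tau> 3 = - v0"
    "vertex \<tau> 4 = - v1" "vertex \<tau> 5 = 1 - v0" "vertex \<tau> 6 = v0"
    unfolding vertex_def len by (simp_all add: l)
  have "{..<length (voronoi_vertices \<tau>)} = {0,1,2,3,4,5}"
    "{..<length (voronoi_vertices \<tau>) div 2} = {0,1,2}" "{1..length (voronoi_vertices \<tau>) div 3} = {1,2}"
    unfolding len by auto
  note ranges = this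
  have succ: "0 + 1 = (1::nat)" "1 + 1 = (2::nat)" "2 + 1 = (3::nat)" "3 + 1 = (4::nat)"
    "4 + 1 = (5::nat)" "5 + 1 = (6::nat)" by simp_all
  show ?thesis
    unfolding restricted_voronoi_cell_def half_open_boundary_def Let_def ranges edge_midpoint_def
      image_insert image_empty UN_insert UN_empty succ v
    by blast
qed

lemma linear_midpoint: "linear f \<Longrightarrow> f (midpoint a b) = (f a + f b) / 2" for f :: "complex \<Rightarrow> real"
  by (simp add: midpoint_def linear_scale linear_add)

lemma half_open_boundary_iff: "z \<in> half_open_boundary \<longleftrightarrow> restricted_boundary r \<beta> (Re z) (form z)"
proof -
  have C: "linear (\<lambda>z. form z - Re z)" and R: "linear Re"
    by (auto intro!: linearI simp: linear_add[OF linear_form] linear_scale[OF linear_form] algebra_simps)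
  note coords = vertex_coordinates vertex_coordinates' linear_midpoint[OF linear_form] linear_midpoint[OF R]
  have inj: "x = 0" if "Re x = 0" "form x = 0" for x
    using that coordinates_inject[of x 0] by (simp add: form_def)
  note seg_B = open_segment_coordinates[OF R linear_form inj, where x = z]
    and seg_C = open_segment_coordinates[OF R C inj, where x = z]
    and seg_A = open_segment_coordinates[OF linear_form R inj, where x = z]
  have e0: "z \<in> open_segment (midpoint v0 v1) v1 \<longleftrightarrow> form z = \<beta> \<and> r - 1/2 < Re z \<and> Re z < r/2"
    using r_bounds seg_B[of v1 \<beta> "midpoint v0 v1"] by (simp add: open_segment_commute coords)
  have e1: "z \<in> open_segment (midpoint v1 (v0 - 1)) (v0 - 1) \<longleftrightarrow>
      form z - Re z = \<beta> + 1/2 - r \<and> - 1/2 < Re z \<and> Re z < (r - 1)/2"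
    using r_bounds seg_C[of "v0 - 1" "\<beta> + 1/2 - r" "midpoint v1 (v0 - 1)"]
    by (auto simp: open_segment_commute coords field_simps simp del: minus_complex.sel)
  have e2: "z \<in> open_segment (midpoint (v0 - 1) (- v0)) (- v0) \<longleftrightarrow>
      Re z = - 1/2 \<and> - \<beta> < form z \<and> form z < - r/2"
    using r_bounds seg_A[of "- v0" "- 1/2" "midpoint (v0 - 1) (- v0)"]
    by (simp add: open_segment_commute coords del: minus_complex.sel uminus_complex.sel)
  have e3: "z \<in> open_segment (midpoint (- v0) (- v1)) (- v1) \<longleftrightarrow>
      form z = - \<beta> \<and> - r/2 < Re z \<and> Re z < 1/2 - r"
    using r_bounds seg_B[of "midpoint (- v0) (- v1)" "- \<beta>" "- v1"]
    by (simp add: coords del: minus_complex.sel uminus_complex.sel)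
  have e4: "z \<in> open_segment (midpoint (- v1) (1 - v0)) (1 - v0) \<longleftrightarrow>
      form z - Re z = - (\<beta> + 1/2 - r) \<and> (1 - r)/2 < Re z \<and> Re z < 1/2"
    using r_bounds seg_C[of "midpoint (- v1) (1 - v0)" "- (\<beta> + 1/2 - r)" "1 - v0"]
    by (auto simp: coords field_simps simp del: minus_complex.sel uminus_complex.sel)
  have e5: "z \<in> open_segment (midpoint (1 - v0) v0) v0 \<longleftrightarrow>
      Re z = 1/2 \<and> r/2 < form z \<and> form z < \<beta>"
    using r_bounds seg_A[of "midpoint (1 - v0) v0" "1/2" v0]
    by (simp add: coords del: minus_complex.sel uminus_complex.sel)
  have points: "z \<in> {midpoint v0 v1, midpoint v1 (v0 - 1), midpoint (v0 - 1) (- v0), v1, v0 - 1} \<longleftrightarrow>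
      Re z = r/2 \<and> form z = \<beta> \<or> Re z = (r - 1)/2 \<and> form z - Re z = \<beta> + 1/2 - r
      \<or> Re z = - 1/2 \<and> form z = - r/2 \<or> Re z = r - 1/2 \<and> form z = \<beta>
      \<or> Re z = - 1/2 \<and> form z = \<beta> - r"
  proof -
    have eq: "z = x \<longleftrightarrow> Re z = Re x \<and> form z = form x" for x
      using coordinates_inject by auto
    show ?thesis
      unfolding insert_iff empty_iff eq coords by (auto simp: field_simps)
  qed
  show ?thesis
    unfolding half_open_boundary_def Un_iff e0 e1 e2 e3 e4 e5 points restricted_boundary_def
    using r_bounds by (intro iffI; elim disjE conjE; auto)
qed

lemma restricted_voronoi_cell_iff:
  "z \<in> restricted_voronoi_cell \<tau> \<longleftrightarrow>
    open_hexagon r \<beta> (Re z) (form z) \<or> restricted_boundary r \<beta> (Re z) (form z)"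
  by (simp add: restricted_voronoi_cell_eq interior_voronoi_cell_iff half_open_boundary_iff)

lemma restricted_voronoi_cell_subset: "restricted_voronoi_cell \<tau> \<subseteq> voronoi_cell \<tau>"
  using restricted_boundary_imp_closed[OF r_bounds]
  by (auto simp: restricted_voronoi_cell_iff voronoi_cell_iff)
    (auto simp: open_hexagon_def closed_hexagon_def)

lemma voronoi_representative:
  assumes "\<And>y. y \<in> int_adjoin \<tau> \<Longrightarrow> norm y < 1 \<Longrightarrow> y = 0"
  obtains y where "y \<in> int_adjoin \<tau>" "z - y \<in> voronoi_cell \<tau>"
proof -
  have diff: "x - y \<in> int_adjoin \<tau>" if xy: "x \<in> int_adjoin \<tau>" "y \<in> int_adjoin \<tau>" for x y
  proof -
    obtain a b c d :: int where "x = of_int a + of_int b * \<tau>" "y = of_int c + of_int d * \<tau>"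
      using xy unfolding adjoin by blast
    then have "x - y = of_int (a - c) + of_int (b - d) * \<tau>" by (simp add: algebra_simps)
    then show ?thesis unfolding adjoin by blast
  qed
  have "closed (int_adjoin \<tau>)"
  proof (rule discrete_imp_closed[of 1], simp, intro ballI impI)
    fix x y assume "x \<in> int_adjoin \<tau>" "y \<in> int_adjoin \<tau>" "dist y x < 1"
    then show "y = x" using assms[OF diff, of y x] by (simp add: dist_norm)
  qed
  moreover have "0 \<in> int_adjoin \<tau>" unfolding adjoin by (intro CollectI exI[of _ "0::int"]) simp
  ultimately obtain y where y: "y \<in> int_adjoin \<tau>" "\<And>x. x \<in> int_adjoin \<tau> \<Longrightarrow> dist z y \<le> dist z x"
    using distance_attains_inf[of "int_adjoin \<tau>" z] by blast
  have add: "x + y \<in> int_adjoin \<tau>" if "x \<in> int_adjoin \<tau>" for x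
    using diff[OF that diff[OF diff[OF y(1) y(1)] y(1)]] by simp
  have "z - y \<in> voronoi_cell \<tau>"
    unfolding voronoi_cell_def using y(2)[OF add] by (auto simp: dist_norm algebra_simps)
  then show ?thesis using that y(1) by blast
qed

text \<open>A nearest lattice point moves \<open>z\<close> into the closed cell; if the result is a boundary point
  outside the restricted cell, then \<open>boundary_translate\<close> moves it inside.\<close>

theorem restricted_cell_representative:
  assumes "\<And>y. y \<in> int_adjoin \<tau> \<Longrightarrow> norm y < 1 \<Longrightarrow> y = 0"
  obtains y where "y \<in> int_adjoin \<tau>" "z - y \<in> restricted_voronoi_cell \<tau>"
proof -
  obtain y where y: "y \<in> int_adjoin \<tau>" "z - y \<in> voronoi_cell \<tau>"
    using voronoi_representative assms by blast
  then have c: "closed_hexagon r \<beta> (Re (z - y)) (form (z - y))" by (simp add: voronoi_cell_iff)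
  show ?thesis
  proof (cases "open_hexagon r \<beta> (Re (z - y)) (form (z - y))")
    case True
    then show ?thesis using that y by (simp add: restricted_voronoi_cell_iff)
  next
    case False
    then obtain m n :: int where
      mn: "restricted_boundary r \<beta> (Re (z - y) - (m + n * r)) (form (z - y) - (m * r + 2 * \<beta> * n))"
      using boundary_translate[OF r_bounds c] by blast
    obtain m' n' :: int where y': "Re y = m' + n' * r" "form y = m' * r + 2 * \<beta> * n'"
      using y(1) unfolding adjoin_coordinates by blast
    define x where "x = of_int (m + m' - (n + n') * \<lfloor>Re \<tau>\<rfloor>) + of_int (n + n') * \<tau>"
    have x: "Re x = m + n * r + Re y" "form x = m * r + 2 * \<beta> * n + form y"
      unfolding y' double_\<beta>
      by (simp_all add: x_def form_def r_def frac_def algebra_simps power2_eq_square)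
    have "x \<in> int_adjoin \<tau>" unfolding x_def adjoin by blast
    moreover have "z - x \<in> restricted_voronoi_cell \<tau>"
      using mn by (simp add: restricted_voronoi_cell_iff linear_diff[OF linear_form] x algebra_simps)
    ultimately show ?thesis using that by blast
  qed
qed

text \<open>If \<open>z\<close> and \<open>z' = z - y\<close> both lie in the cell, then \<open>2 \<langle>z, y\<rangle> \<le> \<bar>y\<bar>\<^sup>2\<close> and
  \<open>- 2 \<langle>z', y\<rangle> \<le> \<bar>y\<bar>\<^sup>2\<close> hold, while the left-hand sides add up to \<open>2 \<bar>y\<bar>\<^sup>2\<close>. So both are
  equalities, and \<open>y\<close> is one of the few vectors in \<open>form_le_norm\<close>.\<close>

theorem restricted_cell_unique:
  assumes z: "z \<in> restricted_voronoi_cell \<tau>" and z': "z' \<in> restricted_voronoi_cell \<tau>"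
    and d: "z - z' \<in> int_adjoin \<tau>"
  shows "z = z'"
proof -
  obtain m n :: int where mn: "Re (z - z') = m + n * r" "form (z - z') = m * r + 2 * \<beta> * n"
    using d unfolding adjoin_coordinates by blast
  define a b a' b' where ab: "a = Re z" "b = form z" "a' = Re z'" "b' = form z'"
  have aa: "a = a' + (m + n * r)" and bb: "b = b' + (m * r + 2 * \<beta> * n)"
    using mn by (simp_all add: ab linear_diff[OF linear_form])
  have c: "closed_hexagon r \<beta> a b" "closed_hexagon r \<beta> a' b'"
    using z z' restricted_voronoi_cell_subset voronoi_cell_iff by (auto simp: ab)
  have le: "2 * (m * a + n * b) \<le> m\<^sup>2 + 2 * real_of_int m * n * r + 2 * \<beta> * n\<^sup>2"
    using form_le_norm(1)[OF r_bounds c(1)] .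
  have le': "- 2 * (m * a' + n * b') \<le> m\<^sup>2 + 2 * real_of_int m * n * r + 2 * \<beta> * n\<^sup>2"
    using form_le_norm(1)[OF r_bounds c(2), of "- m" "- n"] by (simp add: algebra_simps)
  have "2 * (m * a + n * b) - 2 * (m * a' + n * b') = 2 * (m\<^sup>2 + 2 * real_of_int m * n * r + 2 * \<beta> * n\<^sup>2)"
    unfolding aa bb by (simp add: algebra_simps power2_eq_square)
  then have eq: "2 * (m * a + n * b) = m\<^sup>2 + 2 * real_of_int m * n * r + 2 * \<beta> * n\<^sup>2"
    and eq': "2 * (real_of_int (- m) * a' + real_of_int (- n) * b') =
      real_of_int ((- m)\<^sup>2) + 2 * real_of_int (- m) * (- n) * r + 2 * \<beta> * (- n)\<^sup>2"
    using le le' by simp_all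
  show ?thesis
  proof (cases "m = 0 \<and> n = 0")
    case True
    then show ?thesis using aa bb coordinates_inject by (simp add: ab)
  next
    case False
    have strict: "2 * (i * x + j * y) < i\<^sup>2 + 2 * real_of_int i * j * r + 2 * \<beta> * j\<^sup>2"
      if "open_hexagon r \<beta> x y" "(i, j) \<noteq> (0, 0)" for i j :: int and x y :: real
    proof -
      have c: "closed_hexagon r \<beta> x y"
        using that by (auto simp: open_hexagon_def closed_hexagon_def)
      have "2 * (i * x + j * y) \<noteq> i\<^sup>2 + 2 * real_of_int i * j * r + 2 * \<beta> * j\<^sup>2"
      proof
        assume e: "2 * (i * x + j * y) = i\<^sup>2 + 2 * real_of_int i * j * r + 2 * \<beta> * j\<^sup>2"
        show False
          using form_le_norm(2)[OF r_bounds c e] that e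
          by (auto simp: open_hexagon_def abs_less_iff)
      qed
      then show ?thesis using form_le_norm(1)[OF r_bounds c, of i j] by simp
    qed
    have "\<not> open_hexagon r \<beta> a b" "\<not> open_hexagon r \<beta> a' b'"
      using strict[of a b m n] strict[of a' b' "- m" "- n"] eq eq' False by auto
    then have b: "restricted_boundary r \<beta> a b" "restricted_boundary r \<beta> a' b'"
      using z z' by (simp_all add: ab restricted_voronoi_cell_iff)
    have "(m, n) \<in> {(1,0), (0,1), (-1,1)} \<or> (m, n) = (1,1) \<and> r = 0
      \<or> (- m, - n) \<in> {(1,0), (0,1), (-1,1)} \<or> (- m, - n) = (1,1) \<and> r = 0"
      using form_le_norm(2)[OF r_bounds c(1) eq] False by auto
    then have False
      using boundary_unique[OF r_bounds b, of m n] boundary_unique[OF r_bounds b(2,1), of "- m" "- n"]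
        aa bb by (simp add: algebra_simps) blast
    then show ?thesis ..
  qed
qed

end

section \<open>Non-adjacent forms and multi-expansions\<close>

lemma wnaf_expansion_iff:
  "wnaf_expansion w D \<tau> z \<eta> \<longleftrightarrow>
    expansion D \<tau> z \<eta> \<and> (\<forall>i j. i < j \<and> j < i + w \<and> \<eta> i \<noteq> 0 \<longrightarrow> \<eta> j = 0)"
proof -
  have "(\<forall>j. card {n \<in> {j..<j + w}. \<eta> n \<noteq> 0} \<le> 1) \<longleftrightarrow>
    (\<forall>i j. i < j \<and> j < i + w \<and> \<eta> i \<noteq> 0 \<longrightarrow> \<eta> j = 0)" (is "?L \<longleftrightarrow> ?R")
  proof
    assume L: ?L
    show ?R
    proof (intro allI impI, rule ccontr)
      fix i j assume h: "i < j \<and> j < i + w \<and> \<eta> i \<noteq> 0" "\<eta> j \<noteq> 0"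
      then have "{i, j} \<subseteq> {n \<in> {i..<i + w}. \<eta> n \<noteq> 0}" by auto
      from card_mono[OF _ this] show False using L[rule_format, of i] h by simp
    qed
  next
    assume R: ?R
    have "card {n \<in> {j..<j + w}. \<eta> n \<noteq> 0} \<le> Suc 0" for j
    proof (subst card_le_Suc0_iff_eq; (intro ballI)?)
      fix a b assume "a \<in> {n \<in> {j..<j + w}. \<eta> n \<noteq> 0}" "b \<in> {n \<in> {j..<j + w}. \<eta> n \<noteq> 0}"
      then show "a = b" using R[rule_format, of a b] R[rule_format, of b a]
        by (cases a b rule: linorder_cases) auto
    qed simp
    then show ?L by simp
  qed
  then show ?thesis by (simp add: wnaf_expansion_def)
qed

lemma digit_support_case_nat:
  "digit_support (case_nat d \<eta>) = (if d = 0 then {} else {0}) \<union> Suc ` digit_support \<eta>"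
proof (rule set_eqI)
  fix n show "n \<in> digit_support (case_nat d \<eta>) \<longleftrightarrow>
      n \<in> (if d = 0 then {} else {0}) \<union> Suc ` digit_support \<eta>"
    by (cases n) (auto simp: digit_support_def)
qed

lemma sum_digit_support_case_nat:
  assumes "finite (digit_support \<eta>)"
  shows "(\<Sum>n\<in>digit_support (case_nat d \<eta>). case_nat d \<eta> n * \<tau> ^ n)
    = d + \<tau> * (\<Sum>n\<in>digit_support \<eta>. \<eta> n * \<tau> ^ n)"
proof -
  have "(\<Sum>n\<in>Suc ` digit_support \<eta>. case_nat d \<eta> n * \<tau> ^ n)
      = \<tau> * (\<Sum>n\<in>digit_support \<eta>. \<eta> n * \<tau> ^ n)"
    by (simp add: sum.reindex sum_distrib_left mult_ac)
  moreover have "0 \<notin> Suc ` digit_support \<eta>" by auto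
  ultimately show ?thesis using assms by (simp add: digit_support_case_nat)
qed

lemma expansion_case_nat:
  assumes "expansion D \<tau> z \<eta>" "d \<in> D"
  shows "expansion D \<tau> (d + \<tau> * z) (case_nat d \<eta>)"
proof -
  have "finite (digit_support (case_nat d \<eta>))"
    using assms by (auto simp: digit_support_case_nat expansion_def)
  then show ?thesis
    using assms sum_digit_support_case_nat[of \<eta> d \<tau>] by (auto simp: expansion_def split: nat.split)
qed

lemma expansion_tail:
  assumes "expansion D \<tau> z \<eta>"
  obtains z' where "z = \<eta> 0 + \<tau> * z'" "expansion D \<tau> z' (\<lambda>n. \<eta> (Suc n))"
proof -
  let ?\<theta> = "\<lambda>n. \<eta> (Suc n)"
  have \<eta>: "case_nat (\<eta> 0) ?\<theta> = \<eta>" by (auto split: nat.split)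
  have "Suc ` digit_support ?\<theta> \<subseteq> digit_support \<eta>" by (auto simp: digit_support_def)
  moreover have "finite (digit_support \<eta>)" using assms by (simp add: expansion_def)
  ultimately have "finite (Suc ` digit_support ?\<theta>)" by (rule finite_subset)
  then have fin: "finite (digit_support ?\<theta>)" by (rule finite_imageD) simp
  show ?thesis
    using that[of "\<Sum>n\<in>digit_support ?\<theta>. ?\<theta> n * \<tau> ^ n"] assms
      sum_digit_support_case_nat[OF fin, of "\<eta> 0" \<tau>, unfolded \<eta>] fin
    by (auto simp: expansion_def)
qed

lemma wnaf_expansion_tail:
  assumes "wnaf_expansion w D \<tau> z \<eta>"
  obtains z' where "z = \<eta> 0 + \<tau> * z'" "wnaf_expansion w D \<tau> z' (\<lambda>n. \<eta> (Suc n))"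
proof -
  have \<eta>: "expansion D \<tau> z \<eta>" and sparse: "\<And>i j. i < j \<Longrightarrow> j < i + w \<Longrightarrow> \<eta> i \<noteq> 0 \<Longrightarrow> \<eta> j = 0"
    using assms by (auto simp: wnaf_expansion_iff)
  obtain z' where "z = \<eta> 0 + \<tau> * z'" "expansion D \<tau> z' (\<lambda>n. \<eta> (Suc n))"
    using expansion_tail[OF \<eta>] .
  moreover have "\<eta> (Suc j) = 0" if "i < j" "j < i + w" "\<eta> (Suc i) \<noteq> 0" for i j
    using sparse[of "Suc i" "Suc j"] that by simp
  ultimately show ?thesis using that unfolding wnaf_expansion_iff by blast
qed

lemma wnaf_expansion_shift:
  assumes "wnaf_expansion w D \<tau> z \<eta>" "0 \<in> D"
  obtains \<theta> where "wnaf_expansion w D \<tau> (\<tau> ^ k * z) \<theta>" "weight \<theta> = weight \<eta>" "\<forall>n<k. \<theta> n = 0"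
proof -
  have "\<exists>\<theta>. wnaf_expansion w D \<tau> (\<tau> ^ k * z) \<theta> \<and> weight \<theta> = weight \<eta> \<and> (\<forall>n<k. \<theta> n = 0)"
  proof (induction k)
    case 0
    then show ?case using assms by auto
  next
    case (Suc k)
    then obtain \<theta> where \<theta>: "wnaf_expansion w D \<tau> (\<tau> ^ k * z) \<theta>" "weight \<theta> = weight \<eta>" "\<forall>n<k. \<theta> n = 0"
      by auto
    have "expansion D \<tau> (\<tau> ^ Suc k * z) (case_nat 0 \<theta>)"
      using expansion_case_nat[of D \<tau> "\<tau> ^ k * z" \<theta> 0] \<theta>(1) assms(2)
      by (simp add: wnaf_expansion_iff mult.assoc)
    moreover have "case_nat 0 \<theta> j = 0" if "i < j" "j < i + w" "case_nat 0 \<theta> i \<noteq> 0" for i j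
      using that \<theta>(1) by (cases i; cases j) (auto simp: wnaf_expansion_iff)
    moreover have "weight (case_nat 0 \<theta>) = weight \<eta>"
      using \<theta>(2) by (simp add: weight_def digit_support_case_nat card_image)
    moreover have "\<forall>n<Suc k. case_nat 0 \<theta> n = 0"
      using \<theta>(3) by (auto split: nat.split)
    ultimately show ?case unfolding wnaf_expansion_iff by blast
  qed
  then show ?thesis using that by blast
qed

lemma wnaf_expansion_prepend:
  assumes "wnaf_expansion w D \<tau> z \<eta>" "0 \<in> D" "d \<in> D" "d \<noteq> 0" "0 < w"
  obtains \<theta> where "wnaf_expansion w D \<tau> (d + \<tau> ^ w * z) \<theta>" "weight \<theta> = Suc (weight \<eta>)"
proof -
  obtain \<theta> where \<theta>: "wnaf_expansion w D \<tau> (\<tau> ^ (w - 1) * z) \<theta>" "weight \<theta> = weight \<eta>"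
    "\<forall>n<w - 1. \<theta> n = 0"
    using wnaf_expansion_shift assms(1,2) by blast
  have power: "\<tau> * (\<tau> ^ (w - 1) * z) = \<tau> ^ w * z"
    using assms(5) by (simp flip: mult.assoc power_Suc)
  have "expansion D \<tau> (\<tau> ^ (w - 1) * z) \<theta>" using \<theta>(1) unfolding wnaf_expansion_iff ..
  from expansion_case_nat[OF this assms(3)] have "expansion D \<tau> (d + \<tau> ^ w * z) (case_nat d \<theta>)"
    unfolding power .
  moreover have "case_nat d \<theta> j = 0" if "i < j" "j < i + w" "case_nat d \<theta> i \<noteq> 0" for i j
    using that \<theta>(1,3) by (cases i; cases j) (auto simp: wnaf_expansion_iff)
  moreover have "weight (case_nat d \<theta>) = Suc (weight \<eta>)"
  proof -
    have "finite (digit_support \<theta>)" using \<theta>(1) by (simp add: wnaf_expansion_iff expansion_def)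
    then show ?thesis
      using \<theta>(2) assms(4) by (simp add: weight_def digit_support_case_nat card_image card_insert_if image_iff)
  qed
  ultimately show ?thesis using that unfolding wnaf_expansion_iff by blast
qed

definition mset_value :: "complex \<Rightarrow> (complex \<times> nat) multiset \<Rightarrow> complex" where
  "mset_value \<tau> M = (\<Sum>(d, n) \<in># M. d * \<tau> ^ n)"

lemma mset_value_simps [simp]:
  "mset_value \<tau> {#} = 0" "mset_value \<tau> (add_mset (d, n) M) = d * \<tau> ^ n + mset_value \<tau> M"
  "mset_value \<tau> (M + M') = mset_value \<tau> M + mset_value \<tau> M'"
  by (simp_all add: mset_value_def)

definition shift_up :: "nat \<Rightarrow> (complex \<times> nat) multiset \<Rightarrow> (complex \<times> nat) multiset" where
  "shift_up k = image_mset (\<lambda>(d, n). (d, n + k))"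

lemma shift_up_simps [simp]:
  "mset_value \<tau> (shift_up k M) = \<tau> ^ k * mset_value \<tau> M" "size (shift_up k M) = size M"
  by (induction M) (auto simp: shift_up_def algebra_simps power_add)

lemma shift_up_digits: "set_mset (shift_up k M) \<subseteq> A \<times> UNIV \<longleftrightarrow> set_mset M \<subseteq> A \<times> UNIV"
  by (auto simp: shift_up_def)

lemma obtain_shift_up:
  assumes "\<And>d n. (d, n) \<in># M \<Longrightarrow> k \<le> n"
  obtains M' where "M = shift_up k M'"
proof -
  have "image_mset (\<lambda>(d, n). (d, n + k)) (image_mset (\<lambda>(d, n). (d, n - k)) M) = image_mset id M"
    unfolding multiset.map_comp by (rule image_mset_cong) (use assms in auto)
  then show ?thesis using that[of "image_mset (\<lambda>(d, n). (d, n - k)) M"] by (simp add: shift_up_def)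
qed

text \<open>What the combinatorial argument needs of the lattice \<open>L\<close> and the digit set \<open>D\<close>: a bound \<open>\<rho>\<close> for
  the digits, a radius \<open>\<sigma>\<close> below which every point that \<open>\<tau>\<close> does not divide is a digit, and an inequality
  between the two. Norm squares are natural numbers, which provides the inductions.\<close>

locale contracting_digits =
  fixes L D :: "complex set" and \<tau> :: complex and w :: nat and \<rho> \<sigma> :: real
  assumes zero_L: "0 \<in> L"
    and diff_L: "x \<in> L \<Longrightarrow> y \<in> L \<Longrightarrow> x - y \<in> L"
    and base_L: "x \<in> L \<Longrightarrow> \<tau> * x \<in> L"
    and norm_square_nat: "x \<in> L \<Longrightarrow> \<exists>k::nat. (norm x)\<^sup>2 = k"
    and expanding: "1 < norm \<tau>"
    and width: "0 < w"
    and zero_D: "0 \<in> D"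
    and D_subset: "D \<subseteq> L"
    and digit_not_divisible: "d \<in> D \<Longrightarrow> d \<noteq> 0 \<Longrightarrow> y \<in> L \<Longrightarrow> d \<noteq> \<tau> * y"
    and digit_exists: "z \<in> L \<Longrightarrow> (\<And>y. y \<in> L \<Longrightarrow> z \<noteq> \<tau> * y) \<Longrightarrow> \<exists>d\<in>D. \<exists>y\<in>L. z = d + \<tau> ^ w * y"
    and digit_unique: "d \<in> D \<Longrightarrow> d' \<in> D \<Longrightarrow> y \<in> L \<Longrightarrow> d - d' = \<tau> ^ w * y \<Longrightarrow> d = d'"
    and digit_norm: "d \<in> D \<Longrightarrow> norm d \<le> \<rho>"
    and small_digit: "z \<in> L \<Longrightarrow> (\<And>y. y \<in> L \<Longrightarrow> z \<noteq> \<tau> * y) \<Longrightarrow> norm z < \<sigma> \<Longrightarrow> z \<in> D"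
    and radii: "\<sigma> \<le> \<rho>"
    and contraction: "(norm \<tau> ^ (w - 1) + 2) * \<rho> < norm \<tau> ^ w * \<sigma>"
begin

lemma add_L: "x \<in> L \<Longrightarrow> y \<in> L \<Longrightarrow> x + y \<in> L"
  using diff_L[of x "0 - y"] diff_L[OF zero_L, of y] by simp

lemma base_power_L: "x \<in> L \<Longrightarrow> \<tau> ^ k * x \<in> L"
  by (induction k) (auto simp: mult.assoc base_L)

lemma mset_value_L: "set_mset M \<subseteq> (D - {0}) \<times> UNIV \<Longrightarrow> mset_value \<tau> M \<in> L"
proof (induction M)
  case (add x M)
  then show ?case
    using D_subset add_L base_power_L[of "fst x" "snd x"] by (cases x) (auto simp: mult.commute)
qed (simp add: zero_L)

lemma expansion_L: "expansion D \<tau> z \<eta> \<Longrightarrow> z \<in> L"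
  using expansion_imp_multi_expansion(1)[of D \<tau> z \<eta>] mset_value_L
  by (auto simp: multi_expansion_def mset_value_def)

definition norm_square :: "complex \<Rightarrow> nat" where
  "norm_square z = nat \<lfloor>(norm z)\<^sup>2\<rfloor>"

lemma norm_square_less: "x \<in> L \<Longrightarrow> y \<in> L \<Longrightarrow> norm x < norm y \<Longrightarrow> norm_square x < norm_square y"
proof -
  assume "x \<in> L" "y \<in> L" and less: "norm x < norm y"
  then obtain k l :: nat where "(norm x)\<^sup>2 = k" "(norm y)\<^sup>2 = l"
    using norm_square_nat by metis
  moreover have "(norm x)\<^sup>2 < (norm y)\<^sup>2" using less by (simp add: power_strict_mono)
  ultimately show ?thesis by (simp add: norm_square_def)
qed

lemma quotient_norm_less: "z \<noteq> 0 \<Longrightarrow> norm z < norm (\<tau> * z)"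
  using expanding by (simp add: norm_mult)

lemma obtain_not_divisible:
  assumes "z \<in> L" "z \<noteq> 0"
  obtains l z' where "z' \<in> L" "\<And>y. y \<in> L \<Longrightarrow> z' \<noteq> \<tau> * y" "z = \<tau> ^ l * z'" "norm z' \<le> norm z"
proof -
  have "\<exists>l z'. z' \<in> L \<and> (\<forall>y\<in>L. z' \<noteq> \<tau> * y) \<and> z = \<tau> ^ l * z'"
    using assms
  proof (induction "norm_square z" arbitrary: z rule: less_induct)
    case less
    show ?case
    proof (cases "\<exists>y\<in>L. z = \<tau> * y")
      case True
      then obtain y where y: "y \<in> L" "z = \<tau> * y" by blast
      with less.prems have "y \<noteq> 0" by auto
      then obtain l z' where "z' \<in> L" "\<forall>y\<in>L. z' \<noteq> \<tau> * y" "y = \<tau> ^ l * z'"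
        using less.hyps[of y] norm_square_less[of y z] quotient_norm_less[of y] y less.prems by blast
      then show ?thesis using y(2) by (metis mult.assoc power_Suc)
    next
      case False
      then show ?thesis using less.prems by (metis mult_1 power_0)
    qed
  qed
  then obtain l z' where z': "z' \<in> L" "\<forall>y\<in>L. z' \<noteq> \<tau> * y" "z = \<tau> ^ l * z'" by blast
  have "1 * norm z' \<le> norm z"
    unfolding z'(3) norm_mult norm_power using expanding by (intro mult_right_mono one_le_power) auto
  then show ?thesis using that[of z' l] z' by auto
qed

text \<open>Dividing a small point by powers of \<open>\<tau>\<close> makes it smaller, hence ends in a digit.\<close>

lemma single_summand:
  assumes "y \<in> L" "norm y < \<sigma>"
  obtains M where "set_mset M \<subseteq> (D - {0}) \<times> UNIV" "mset_value \<tau> M = y" "size M \<le> 1"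
proof (cases "y = 0")
  case True
  then show ?thesis using that[of "{#}"] by simp
next
  case False
  then obtain l y' where y': "y' \<in> L" "\<And>x. x \<in> L \<Longrightarrow> y' \<noteq> \<tau> * x" "y = \<tau> ^ l * y'" "norm y' \<le> norm y"
    using obtain_not_divisible assms by metis
  then have "y' \<in> D" "y' \<noteq> 0" using small_digit assms False by auto
  then show ?thesis using that[of "{#(y', l)#}"] y' by simp
qed

text \<open>A rewriting step by \<open>few_summands\<close> lowers this number whenever it preserves the size.\<close>

definition low :: "(complex \<times> nat) multiset \<Rightarrow> nat" where
  "low M = size (filter_mset (\<lambda>(d, n). n < w) M)"

lemma low_simps [simp]:
  "low {#} = 0" "low (add_mset (d, n) M) = (if n < w then Suc (low M) else low M)"
  "low (M + M') = low M + low M'"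
  by (simp_all add: low_def)

lemma low_shift_up: "w \<le> k \<Longrightarrow> low (shift_up k M) = 0"
  by (induction M) (auto simp: low_def shift_up_def)

text \<open>The bound on \<open>u\<close> is that for a sum of two digit terms with exponents \<open>0\<close> and \<open>k < w\<close>. After
  division by a power of \<open>\<tau>\<close> and removal of the lowest digit, what remains is small enough for
  \<open>single_summand\<close>.\<close>

lemma few_summands:
  assumes u: "u \<in> L" "norm u \<le> (norm \<tau> ^ (w - 1) + 1) * \<rho>"
  obtains M where "set_mset M \<subseteq> (D - {0}) \<times> UNIV" "mset_value \<tau> M = u" "size M \<le> 2" "low M \<le> 1"
proof (cases "u = 0")
  case True
  then show ?thesis using that[of "{#}"] by simp
next
  case False
  then obtain l u' where u': "u' \<in> L" "\<And>x. x \<in> L \<Longrightarrow> u' \<noteq> \<tau> * x" "u = \<tau> ^ l * u'" "norm u' \<le> norm u"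
    using obtain_not_divisible u by metis
  then obtain e y where e: "e \<in> D" "y \<in> L" "u' = e + \<tau> ^ w * y"
    using digit_exists by blast
  have "e \<noteq> 0"
  proof
    assume "e = 0"
    then have "u' = \<tau> * (\<tau> ^ (w - 1) * y)" using e(3) width by (simp flip: mult.assoc power_Suc)
    then show False using u'(2) base_power_L e(2) by blast
  qed
  have "norm \<tau> ^ w * norm y = norm (u' - e)" by (simp add: e(3) norm_mult norm_power)
  also have "\<dots> \<le> norm u' + norm e" by (rule norm_triangle_ineq4)
  also have "\<dots> \<le> (norm \<tau> ^ (w - 1) + 1) * \<rho> + \<rho>"
    using u(2) u'(4) digit_norm[OF e(1)] by linarith
  also have "\<dots> < norm \<tau> ^ w * \<sigma>" using contraction by (simp add: algebra_simps)
  finally have "norm y < \<sigma>"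
    by (rule mult_left_less_imp_less) simp
  then obtain M where M: "set_mset M \<subseteq> (D - {0}) \<times> UNIV" "mset_value \<tau> M = y" "size M \<le> 1"
    using single_summand e(2) by blast
  \<comment> \<open>A second term, if there is one, carries the factor \<open>\<tau> ^ w\<close>, so only \<open>e\<close> can be low.\<close>
  show ?thesis
  proof (rule that[of "add_mset (e, l) (shift_up (l + w) M)"])
    show "set_mset (add_mset (e, l) (shift_up (l + w) M)) \<subseteq> (D - {0}) \<times> UNIV"
      using shift_up_digits[of "l + w" M] M(1) e(1) \<open>e \<noteq> 0\<close> by simp
    show "mset_value \<tau> (add_mset (e, l) (shift_up (l + w) M)) = u"
      by (simp add: M(2) u'(3) e(3) algebra_simps power_add)
  qed (use M(3) low_shift_up[of "l + w" M] in auto)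
qed

text \<open>Induction on the size of the multi-expansion, then on the norm of its value, then on the number
  of low terms. If all exponents are positive, the value can be divided by \<open>\<tau>\<close>. If there is a term
  with exponent \<open>0\<close> and another low one, \<open>few_summands\<close> rewrites the two. Otherwise the term with
  exponent \<open>0\<close> is the lowest digit of a \<open>w\<close>-NAF. The norm is needed because a rewritten
  pair may have a positive lowest exponent, after whose removal other terms become low.\<close>

theorem wnaf_not_heavier:
  assumes "set_mset M \<subseteq> (D - {0}) \<times> UNIV"
  shows "\<exists>\<eta>. wnaf_expansion w D \<tau> (mset_value \<tau> M) \<eta> \<and> weight \<eta> \<le> size M"
  using assms
proof (induction M rule: wf_induct_rule[OF wf_measures[of "[size, norm_square \<circ> mset_value \<tau>, low]"]])
  case (1 M)
  note IH = "1.IH"[unfolded in_measures, simplified] and digits = "1.prems"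
  consider (zero) "mset_value \<tau> M = 0" | (divisible) "mset_value \<tau> M \<noteq> 0" "\<And>d n. (d, n) \<in># M \<Longrightarrow> 1 \<le> n"
    | (lowest) d where "(d, 0) \<in># M"
    by (metis One_nat_def Suc_leI not_gr_zero)
  then show ?case
  proof cases
    case zero
    have "wnaf_expansion w D \<tau> 0 (\<lambda>_. 0)"
      by (simp add: wnaf_expansion_iff expansion_def digit_support_def zero_D)
    moreover have "weight (\<lambda>_. 0) = 0" by (simp add: weight_def digit_support_def)
    ultimately show ?thesis using zero by (metis zero_le)
  next
    case divisible
    then obtain M' where M': "M = shift_up 1 M'" using obtain_shift_up by blast
    then have digits': "set_mset M' \<subseteq> (D - {0}) \<times> UNIV" using digits shift_up_digits by blast
    have total: "mset_value \<tau> M = \<tau> * mset_value \<tau> M'" by (simp add: M')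
    then have "norm_square (mset_value \<tau> M') < norm_square (mset_value \<tau> M)"
      using divisible(1) norm_square_less[OF mset_value_L[OF digits'] mset_value_L[OF digits]]
        quotient_norm_less[of "mset_value \<tau> M'"] by auto
    then obtain \<eta> where \<eta>: "wnaf_expansion w D \<tau> (mset_value \<tau> M') \<eta>" "weight \<eta> \<le> size M"
      using IH[of M'] digits' by (auto simp: M')
    then obtain \<theta> where "wnaf_expansion w D \<tau> (\<tau> ^ 1 * mset_value \<tau> M') \<theta>" "weight \<theta> = weight \<eta>"
      using wnaf_expansion_shift zero_D by metis
    then show ?thesis using \<eta>(2) total by auto
  next
    case lowest
    then obtain M1 where M1: "M = add_mset (d, 0) M1" by (metis insert_DiffM)
    show ?thesis
    proof (cases "\<exists>(c, k)\<in>#M1. k < w")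
      case True
      then obtain c k M2 where M2: "M1 = add_mset (c, k) M2" and k: "k < w"
        by (auto dest!: multi_member_split)
      define u where "u = d + c * \<tau> ^ k"
      have dc: "d \<in> D" "c \<in> D" using digits by (auto simp: M1 M2)
      have "0 \<le> \<rho>" using digit_norm[OF zero_D] by simp
      have "norm u \<le> norm d + norm c * norm \<tau> ^ k"
        unfolding u_def by (metis norm_mult norm_power norm_triangle_ineq)
      also have "\<dots> \<le> \<rho> + \<rho> * norm \<tau> ^ (w - 1)"
        using digit_norm dc k expanding \<open>0 \<le> \<rho>\<close> by (intro add_mono mult_mono power_increasing) auto
      finally have "norm u \<le> (norm \<tau> ^ (w - 1) + 1) * \<rho>" by (simp add: algebra_simps)
      moreover have "u \<in> L"
        unfolding u_def using dc D_subset add_L base_power_L[of c k] by (auto simp: mult.commute)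
      ultimately obtain P where P: "set_mset P \<subseteq> (D - {0}) \<times> UNIV" "mset_value \<tau> P = u"
        "size P \<le> 2" "low P \<le> 1"
        using few_summands by blast
      have total: "mset_value \<tau> (P + M2) = mset_value \<tau> M" by (simp add: P M1 M2 u_def)
      have digits': "set_mset (P + M2) \<subseteq> (D - {0}) \<times> UNIV" using P(1) digits by (auto simp: M1 M2)
      have "size (P + M2) < size M \<or> size (P + M2) = size M \<and> low (P + M2) < low M"
        using P(3,4) k by (auto simp: M1 M2)
      then have "\<exists>\<eta>. wnaf_expansion w D \<tau> (mset_value \<tau> (P + M2)) \<eta> \<and> weight \<eta> \<le> size (P + M2)"
        using IH[of "P + M2"] total digits' by auto
      moreover have "size (P + M2) \<le> size M" using P(3) by (simp add: M1 M2)
      ultimately show ?thesis unfolding total by (meson le_trans)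
    next
      case False
      then have "\<And>c k. (c, k) \<in># M1 \<Longrightarrow> w \<le> k" by (auto simp: not_less)
      then obtain M' where M': "M1 = shift_up w M'" using obtain_shift_up by blast
      then have digits': "set_mset M' \<subseteq> (D - {0}) \<times> UNIV"
        using digits shift_up_digits by (simp add: M1)
      have "size M' < size M" by (simp add: M1 M')
      then obtain \<eta> where \<eta>: "wnaf_expansion w D \<tau> (mset_value \<tau> M') \<eta>" "weight \<eta> \<le> size M'"
        using IH[of M'] digits' by auto
      obtain \<theta> where "wnaf_expansion w D \<tau> (d + \<tau> ^ w * mset_value \<tau> M') \<theta>" "weight \<theta> = Suc (weight \<eta>)"
        using wnaf_expansion_prepend[OF \<eta>(1) zero_D, of d] digits width by (auto simp: M1)
      then show ?thesis using \<eta>(2) by (auto simp: M1 M')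
    qed
  qed
qed

text \<open>Division by \<open>\<tau>\<close> or \<open>\<tau> ^ w\<close> with remainder lowers the norm of every point outside the disc of radius
  \<open>\<sigma>\<close>, and the points inside are covered by \<open>single_summand\<close>.\<close>

lemma multi_expansion_exists:
  "z \<in> L \<Longrightarrow> \<exists>M. set_mset M \<subseteq> (D - {0}) \<times> UNIV \<and> mset_value \<tau> M = z"
proof (induction "norm_square z" arbitrary: z rule: less_induct)
  case less
  have *: ?case if y: "y \<in> L" "norm y < norm z" and d: "d \<in> D" "z = d + \<tau> ^ k * y" for y d k
  proof -
    obtain M where M: "set_mset M \<subseteq> (D - {0}) \<times> UNIV" "mset_value \<tau> M = y"
      using less.hyps[of y] norm_square_less y less.prems by blast
    let ?M = "(if d = 0 then {#} else {#(d, 0)#}) + shift_up k M"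
    have "set_mset ?M \<subseteq> (D - {0}) \<times> UNIV" using M(1) d(1) shift_up_digits[of k M] by auto
    moreover have "mset_value \<tau> ?M = z" using M(2) d(2) by simp
    ultimately show ?thesis by blast
  qed
  consider "norm z < \<sigma>" | y where "y \<in> L" "z = \<tau> * y" "\<sigma> \<le> norm z"
    | "\<And>y. y \<in> L \<Longrightarrow> z \<noteq> \<tau> * y" "\<sigma> \<le> norm z"
    by (meson not_less)
  then show ?case
  proof cases
    case 1
    then show ?thesis using single_summand less.prems by metis
  next
    case 2
    show ?thesis
    proof (cases "z = 0")
      case True
      then show ?thesis by (intro exI[of _ "{#}"]) simp
    next
      case False
      then have "norm y < norm z" using 2 quotient_norm_less[of y] by auto
      then show ?thesis using *[of y 0 1] 2 zero_D by simp
    qed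
  next
    case 3
    then obtain d y where d: "d \<in> D" "y \<in> L" "z = d + \<tau> ^ w * y"
      using digit_exists less.prems by blast
    have "norm \<tau> ^ w * norm y = norm (z - d)" by (simp add: d norm_mult norm_power)
    also have "\<dots> \<le> norm z + \<rho>"
      using norm_triangle_ineq4[of z d] digit_norm[OF d(1)] by linarith
    also have "\<dots> < norm \<tau> ^ w * norm z"
    proof -
      have \<rho>: "0 \<le> \<rho>" using digit_norm[OF zero_D] by simp
      have one: "1 \<le> norm \<tau> ^ w" "1 \<le> norm \<tau> ^ (w - 1)" using expanding by (simp_all add: one_le_power)
      have "\<rho> < (norm \<tau> ^ w - 1) * \<sigma>"
        using contraction radii mult_right_mono[OF one(2) \<rho>] \<rho> by (simp add: algebra_simps)
      also have "\<dots> \<le> (norm \<tau> ^ w - 1) * norm z"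
        using 3 one by (intro mult_left_mono) auto
      finally show ?thesis by (simp add: algebra_simps)
    qed
    finally have "norm y < norm z"
      by (rule mult_left_less_imp_less) simp
    then show ?thesis using * d by blast
  qed
qed

text \<open>A non-zero lowest digit is followed by \<open>w - 1\<close> zeros, so it represents \<open>z\<close> modulo \<open>\<tau> ^ w\<close>.\<close>

lemma wnaf_lowest_digit:
  assumes "wnaf_expansion w D \<tau> z \<eta>"
  shows "\<eta> 0 = 0 \<Longrightarrow> \<exists>y\<in>L. z = \<tau> * y"
    and "\<eta> 0 \<noteq> 0 \<Longrightarrow> \<exists>y\<in>L. z = \<eta> 0 + \<tau> ^ w * y"
proof -
  have tails: "\<exists>y\<in>L. z = \<tau> ^ k * y"
    if "expansion D \<tau> z \<eta>" "\<forall>n<k. \<eta> n = 0" for z \<eta> k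
    using that
  proof (induction k arbitrary: z \<eta>)
    case 0
    then show ?case using expansion_L by auto
  next
    case (Suc k)
    then obtain z' where z': "z = \<tau> * z'" "expansion D \<tau> z' (\<lambda>n. \<eta> (Suc n))"
      using expansion_tail[of D \<tau> z \<eta>] by (metis add_0 zero_less_Suc)
    then obtain y where "y \<in> L" "z' = \<tau> ^ k * y" using Suc.IH[OF z'(2)] Suc.prems(2) by auto
    then show ?case using z'(1) by (auto simp: mult.assoc)
  qed
  obtain z' where z': "z = \<eta> 0 + \<tau> * z'" "expansion D \<tau> z' (\<lambda>n. \<eta> (Suc n))"
    using wnaf_expansion_tail[OF assms] by (auto simp: wnaf_expansion_iff)
  show "\<eta> 0 = 0 \<Longrightarrow> \<exists>y\<in>L. z = \<tau> * y"
    using z' expansion_L by auto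
  assume "\<eta> 0 \<noteq> 0"
  then have "\<forall>n<w - 1. \<eta> (Suc n) = 0"
    using assms unfolding wnaf_expansion_iff by (metis One_nat_def Suc_less_eq Suc_pred add_0 width zero_less_Suc)
  then obtain y where "y \<in> L" "z' = \<tau> ^ (w - 1) * y" using tails[OF z'(2)] by blast
  then show "\<exists>y\<in>L. z = \<eta> 0 + \<tau> ^ w * y"
    using z'(1) width by (auto simp flip: mult.assoc power_Suc)
qed

lemma wnaf_lowest_digit_unique:
  assumes "wnaf_expansion w D \<tau> z \<eta>" "wnaf_expansion w D \<tau> z \<theta>"
  shows "\<eta> 0 = \<theta> 0"
proof -
  have D: "\<eta> 0 \<in> D" "\<theta> 0 \<in> D" using assms by (auto simp: wnaf_expansion_iff expansion_def)
  have mixed: False if wn: "wnaf_expansion w D \<tau> z \<eta>" "wnaf_expansion w D \<tau> z \<theta>"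
    and 0: "\<eta> 0 = 0" "\<theta> 0 \<noteq> 0" for \<eta> \<theta>
  proof -
    obtain x y where "x \<in> L" "y \<in> L" "\<tau> * x = \<theta> 0 + \<tau> ^ w * y"
      using wnaf_lowest_digit wn 0 by metis
    moreover from this have "\<theta> 0 = \<tau> * (x - \<tau> ^ (w - 1) * y)"
      using width by (simp add: right_diff_distrib flip: mult.assoc power_Suc)
    moreover have "\<theta> 0 \<in> D" using wn by (auto simp: wnaf_expansion_iff expansion_def)
    ultimately show False using digit_not_divisible 0 diff_L base_power_L by metis
  qed
  show ?thesis
  proof (cases "\<eta> 0 = 0 \<or> \<theta> 0 = 0")
    case True
    then show ?thesis using mixed assms by metis
  next
    case False
    then obtain x y where "x \<in> L" "y \<in> L" "\<eta> 0 + \<tau> ^ w * x = \<theta> 0 + \<tau> ^ w * y"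
      using wnaf_lowest_digit assms by metis
    then have "\<eta> 0 - \<theta> 0 = \<tau> ^ w * (y - x)" "y - x \<in> L" by (auto simp: algebra_simps diff_L)
    then show ?thesis using digit_unique D by blast
  qed
qed

text \<open>The lowest digit is determined by the value; cancel it, divide by \<open>\<tau>\<close> and repeat.\<close>

theorem wnaf_unique:
  assumes "wnaf_expansion w D \<tau> z \<eta>" "wnaf_expansion w D \<tau> z \<theta>"
  shows "\<eta> = \<theta>"
proof
  fix n
  show "\<eta> n = \<theta> n"
    using assms
  proof (induction n arbitrary: z \<eta> \<theta>)
    case 0
    then show ?case using wnaf_lowest_digit_unique by blast
  next
    case (Suc n)
    obtain x y where x: "z = \<eta> 0 + \<tau> * x" "wnaf_expansion w D \<tau> x (\<lambda>n. \<eta> (Suc n))"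
      and y: "z = \<theta> 0 + \<tau> * y" "wnaf_expansion w D \<tau> y (\<lambda>n. \<theta> (Suc n))"
      using wnaf_expansion_tail Suc.prems by metis
    have "\<tau> \<noteq> 0" using expanding by auto
    then have "x = y" using x(1) y(1) wnaf_lowest_digit_unique[OF Suc.prems] by simp
    then show ?case using Suc.IH x(2) y(2) by blast
  qed
qed

theorem wnaf_optimal:
  assumes "z \<in> L"
  shows "\<exists>!\<eta>. wnaf_expansion w D \<tau> z \<eta>"
    and "wnaf_expansion w D \<tau> z \<eta> \<Longrightarrow> optimal_expansion D \<tau> z \<eta>"
proof -
  show "\<exists>!\<eta>. wnaf_expansion w D \<tau> z \<eta>"
    using multi_expansion_exists[OF assms] wnaf_not_heavier wnaf_unique by metis
  assume \<eta>: "wnaf_expansion w D \<tau> z \<eta>"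
  have "weight \<eta> \<le> size M" if "multi_expansion D \<tau> z M" for M
    using that wnaf_not_heavier[of M] wnaf_unique[OF \<eta>]
    by (auto simp: multi_expansion_def mset_value_def)
  then show "optimal_expansion D \<tau> z \<eta>"
    using \<eta> by (simp add: optimal_expansion_def wnaf_expansion_iff)
qed

end

section \<open>Imaginary quadratic bases\<close>

locale quadratic_integer =
  fixes p q :: int and \<tau> :: complex
  assumes disc: "0 < real_of_int q - (real_of_int p)\<^sup>2 / 4"
    and root: "\<tau>\<^sup>2 - of_int p * \<tau> + of_int q = 0"
begin

lemma Re_base: "Re \<tau> = p / 2"
  and Im_base: "(Im \<tau>)\<^sup>2 = q - (real_of_int p)\<^sup>2 / 4"
proof -
  have re: "(Re \<tau>)\<^sup>2 - (Im \<tau>)\<^sup>2 - p * Re \<tau> + q = 0" and im: "Im \<tau> * (2 * Re \<tau> - p) = 0"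
    using arg_cong[OF root, of Re] arg_cong[OF root, of Im]
    by (simp_all add: power2_eq_square algebra_simps)
  have "Im \<tau> \<noteq> 0"
  proof
    assume "Im \<tau> = 0"
    then have "(Re \<tau> - p / 2)\<^sup>2 = (real_of_int p)\<^sup>2 / 4 - q"
      using re by (simp add: power2_eq_square algebra_simps)
    then show False using disc zero_le_power2[of "Re \<tau> - p / 2"] by simp
  qed
  then show R: "Re \<tau> = p / 2" using im by simp
  then show "(Im \<tau>)\<^sup>2 = q - (real_of_int p)\<^sup>2 / 4"
    using re unfolding R by (simp add: power2_eq_square field_simps)
qed

lemma norm_base: "(norm \<tau>)\<^sup>2 = q"
  unfolding cmod_power2 Re_base Im_base by (simp add: power_divide)

lemma q_pos: "0 < q"
proof -
  have "0 \<le> (real_of_int p)\<^sup>2 / 4" by simp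
  then show ?thesis using disc by linarith
qed

lemma int_adjoin_eq: "int_adjoin \<tau> = {of_int m + of_int n * \<tau> | m n. True}"
proof (intro equalityI subsetI)
  fix y assume "y \<in> int_adjoin \<tau>"
  then obtain f :: "int poly" where y: "y = poly (map_poly of_int f) \<tau>" by (auto simp: int_adjoin_def)
  have sq: "\<tau> * \<tau> = of_int p * \<tau> - of_int q" using root by (simp add: power2_eq_square algebra_simps)
  have "\<exists>(m::int) (n::int). poly (map_poly of_int f) \<tau> = of_int m + of_int n * \<tau>"
  proof (induction f)
    case 0
    show ?case by (intro exI[of _ 0]) simp
  next
    case (pCons a f)
    then obtain m n :: int where mn: "poly (map_poly of_int f) \<tau> = of_int m + of_int n * \<tau>" by blast
    have "poly (map_poly of_int (pCons a f)) \<tau> = of_int a + \<tau> * (of_int m + of_int n * \<tau>)"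
      by (simp add: map_poly_pCons mn)
    also have "\<dots> = of_int a + of_int m * \<tau> + of_int n * (\<tau> * \<tau>)" by (simp add: algebra_simps)
    also have "\<dots> = of_int (a - n * q) + of_int (m + n * p) * \<tau>"
      unfolding sq by (simp add: algebra_simps)
    finally show ?case by blast
  qed
  then show "y \<in> {of_int m + of_int n * \<tau> | m n. True}" using y by blast
next
  fix y assume "y \<in> {of_int m + of_int n * \<tau> | m n. True}"
  then obtain m n :: int where "y = of_int m + of_int n * \<tau>" by blast
  then have "y = poly (map_poly of_int [:m, n:]) \<tau>" by (simp add: map_poly_pCons mult.commute)
  then show "y \<in> int_adjoin \<tau>" unfolding int_adjoin_def by blast
qed

lemma zero_int_adjoin: "0 \<in> int_adjoin \<tau>"
  unfolding int_adjoin_eq by (intro CollectI exI[of _ "0::int"]) simp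

lemma int_adjoin_diff: "x \<in> int_adjoin \<tau> \<Longrightarrow> y \<in> int_adjoin \<tau> \<Longrightarrow> x - y \<in> int_adjoin \<tau>"
  unfolding int_adjoin_eq mem_Collect_eq
proof (elim exE conjE)
  fix a b c d :: int
  assume "x = of_int a + of_int b * \<tau>" "y = of_int c + of_int d * \<tau>"
  then have "x - y = of_int (a - c) + of_int (b - d) * \<tau>" by (simp add: algebra_simps)
  then show "\<exists>m n. x - y = of_int m + of_int n * \<tau> \<and> True" by blast
qed

lemma int_adjoin_base_mult: "x \<in> int_adjoin \<tau> \<Longrightarrow> \<tau> * x \<in> int_adjoin \<tau>"
  unfolding int_adjoin_def
proof (elim imageE)
  fix f :: "int poly" assume "x = poly (map_poly of_int f) \<tau>"
  then have "\<tau> * x = poly (map_poly of_int (pCons 0 f)) \<tau>" by (simp add: map_poly_pCons)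
  then show "\<tau> * x \<in> range (\<lambda>f :: int poly. poly (map_poly of_int f) \<tau>)" by blast
qed

lemma int_adjoin_base_power: "x \<in> int_adjoin \<tau> \<Longrightarrow> \<tau> ^ k * x \<in> int_adjoin \<tau>"
  by (induction k) (auto simp: mult.assoc int_adjoin_base_mult)

lemma int_adjoin_norm_square:
  assumes "y \<in> int_adjoin \<tau>"
  shows "\<exists>k::nat. (norm y)\<^sup>2 = k"
proof -
  obtain m n :: int where y: "y = of_int m + of_int n * \<tau>" using assms unfolding int_adjoin_eq by blast
  have "(norm y)\<^sup>2 = (m + n * (p / 2))\<^sup>2 + (real_of_int n)\<^sup>2 * (Im \<tau>)\<^sup>2"
    by (simp add: y cmod_power2 Re_base power_mult_distrib)
  also have "\<dots> = of_int (m * m + m * n * p + n * n * q)"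
    unfolding Im_base by (simp add: power2_eq_square field_simps)
  finally have eq: "(norm y)\<^sup>2 = of_int (m * m + m * n * p + n * n * q)" .
  then have "0 \<le> m * m + m * n * p + n * n * q"
    by (metis of_int_0_le_iff zero_le_power2)
  then show ?thesis using eq by (metis nonneg_int_cases of_int_of_nat_eq)
qed

lemma int_adjoin_discrete: "y \<in> int_adjoin \<tau> \<Longrightarrow> norm y < 1 \<Longrightarrow> y = 0"
proof -
  assume y: "y \<in> int_adjoin \<tau>" and less: "norm y < 1"
  obtain k :: nat where k: "(norm y)\<^sup>2 = k" using int_adjoin_norm_square y by blast
  have "(norm y)\<^sup>2 < 1" using less by (simp add: power_less_one_iff)
  then show "y = 0" using k by simp
qed

lemma frac_Re_base: "frac (Re \<tau>) = (if even p then 0 else 1/2)"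
proof (cases "even p")
  case True
  then show ?thesis unfolding Re_base by (auto elim!: evenE)
next
  case False
  then obtain k where k: "p = 2 * k + 1" by (elim oddE)
  have half: "Re \<tau> = k + 1/2" unfolding Re_base k by (simp add: field_simps)
  have "\<lfloor>Re \<tau>\<rfloor> = k" unfolding half by (simp add: floor_eq_iff)
  then show ?thesis using False by (simp add: frac_def half)
qed

text \<open>If \<open>p\<close> is odd, then \<open>4 q - p\<^sup>2\<close> is a positive integer congruent to \<open>3\<close> modulo \<open>4\<close>.\<close>

lemma odd_height: "odd p \<Longrightarrow> 3/4 \<le> (Im \<tau>)\<^sup>2"
proof -
  assume "odd p"
  then obtain k where k: "p = 2 * k + 1" by (elim oddE)
  have "4 * (Im \<tau>)\<^sup>2 = of_int (4 * (q - k * k - k) - 1)"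
    unfolding Im_base k by (simp add: power2_eq_square field_simps)
  moreover from this have "0 < 4 * (q - k * k - k) - 1"
    using disc Im_base by (metis mult_pos_pos of_int_0_less_iff zero_less_numeral)
  then have "3 \<le> 4 * (q - k * k - k) - 1" by presburger
  then have "3 \<le> real_of_int (4 * (q - k * k - k) - 1)" by linarith
  ultimately show ?thesis by linarith
qed

sublocale reduced_lattice \<tau>
proof
  show "int_adjoin \<tau> = {of_int m + of_int n * \<tau> | m n. True}" by (rule int_adjoin_eq)
  show "frac (Re \<tau>) * (1 - frac (Re \<tau>)) < (Im \<tau>)\<^sup>2"
    using odd_height disc by (auto simp: frac_Re_base Im_base)
qed

text \<open>The squared diameter of the circle through the vertices, which are \<open>(\<plusminus> 1/2, \<plusminus> Im \<tau> / 2)\<close> for even \<open>p\<close>; for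
  odd \<open>p\<close> one of the vertices is \<open>v1\<close>, on the imaginary axis.\<close>

definition circumdiameter_square :: real where
  "circumdiameter_square =
    (if even p then (Im \<tau>)\<^sup>2 + 1 else ((Im \<tau>)\<^sup>2 + 1/4)\<^sup>2 / (Im \<tau>)\<^sup>2)"

lemma voronoi_cell_norm:
  assumes "z \<in> voronoi_cell \<tau>"
  shows "4 * (norm z)\<^sup>2 \<le> circumdiameter_square"
proof -
  define s where "s = (Im \<tau>)\<^sup>2"
  define a c where "a = Re z" and "c = Im \<tau> * Im z"
  have s: "0 < s" using disc by (simp add: s_def Im_base)
  have norm_z: "(norm z)\<^sup>2 * s = a\<^sup>2 * s + c\<^sup>2"
    by (simp add: cmod_power2 a_def c_def s_def algebra_simps)
  have hex: "closed_hexagon r ((r\<^sup>2 + s) / 2) a (r * a + c)"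
    using assms by (simp add: voronoi_cell_iff \<beta>_def form_def s_def a_def c_def)
  have "4 * (a\<^sup>2 * s + c\<^sup>2) \<le> circumdiameter_square * s"
  proof (cases "even p")
    case True
    then have "\<bar>a\<bar> \<le> 1/2" "\<bar>c\<bar> \<le> s/2"
      using hex by (auto simp: closed_hexagon_def r_def frac_Re_base)
    then have "a\<^sup>2 \<le> (1/2)\<^sup>2" "c\<^sup>2 \<le> (s/2)\<^sup>2"
      using s by (simp_all add: abs_le_square_iff[symmetric])
    then have "a\<^sup>2 * s \<le> (1/2)\<^sup>2 * s" "c\<^sup>2 \<le> (s/2)\<^sup>2" using s by simp_all
    moreover have "circumdiameter_square = s + 1"
      using True by (simp add: circumdiameter_square_def s_def)
    ultimately show ?thesis by (simp add: power2_eq_square algebra_simps)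
  next
    case False
    define b where "b = (1/4 + s) / 2"
    have r: "r = 1/2" using False by (simp add: r_def frac_Re_base)
    have "((1/2)\<^sup>2 + s) / 2 = b" by (simp add: b_def power2_eq_square)
    then have "\<bar>a\<bar> \<le> 1/2" "\<bar>a / 2 + c\<bar> \<le> b" "\<bar>a / 2 + c - a\<bar> \<le> b"
      using hex unfolding r closed_hexagon_def by simp_all
    then obtain x where x: "0 \<le> x" "x \<le> 1/2" "\<bar>c\<bar> \<le> b - x / 2" "a\<^sup>2 = x\<^sup>2"
      by (intro that[of "\<bar>a\<bar>"]) (simp, linarith+, simp)
    then have "c\<^sup>2 \<le> (b - x / 2)\<^sup>2"
      by (simp add: abs_le_square_iff[symmetric])
    then have "a\<^sup>2 * s + c\<^sup>2 \<le> b\<^sup>2 - b * x * (1 - 2 * x)"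
      unfolding b_def x(4) by (simp add: power2_eq_square field_simps)
    also have "\<dots> \<le> b\<^sup>2"
      using x s by (simp add: b_def)
    finally have "4 * (a\<^sup>2 * s + c\<^sup>2) \<le> 4 * b\<^sup>2" by simp
    also have "\<dots> = (s + 1/4)\<^sup>2" by (simp add: b_def power2_eq_square field_simps)
    also have "\<dots> = circumdiameter_square * s"
      using False s by (simp add: circumdiameter_square_def s_def)
    finally show ?thesis .
  qed
  then have "(4 * (norm z)\<^sup>2) * s \<le> circumdiameter_square * s"
    using norm_z by (simp add: mult.assoc)
  then show ?thesis using s by simp
qed

lemma circumdiameter_ge_1: "1 \<le> circumdiameter_square"
proof -
  have "(Im \<tau>)\<^sup>2 \<le> ((Im \<tau>)\<^sup>2 + 1/4)\<^sup>2"
    using zero_le_power2[of "(Im \<tau>)\<^sup>2 - 1/4"] by (simp add: power2_eq_square algebra_simps)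
  then show ?thesis using disc by (simp add: circumdiameter_square_def Im_base)
qed

text \<open>Non-zero lattice points have norm at least \<open>1\<close>, so the open disc of radius \<open>1/2\<close> is an open
  subset of the Voronoi cell.\<close>

lemma ball_subset_restricted_cell:
  assumes "norm z < 1/2"
  shows "z \<in> restricted_voronoi_cell \<tau>"
proof -
  have "ball 0 (1/2) \<subseteq> voronoi_cell \<tau>"
  proof
    fix x :: complex assume "x \<in> ball 0 (1/2)"
    then have x: "norm x < 1/2" by simp
    have "norm x \<le> norm (x - y)" if "y \<in> int_adjoin \<tau>" for y
    proof (cases "y = 0")
      case False
      then have "1 \<le> norm y" using int_adjoin_discrete that not_less by blast
      then show ?thesis using x norm_triangle_ineq2[of y x] by (simp add: norm_minus_commute)
    qed simp
    then show "x \<in> voronoi_cell \<tau>" by (simp add: voronoi_cell_def)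
  qed
  then have "ball 0 (1/2) \<subseteq> interior (voronoi_cell \<tau>)" by (rule interior_maximal) simp
  then have "z \<in> interior (voronoi_cell \<tau>)" using assms by (auto simp: subset_iff)
  then show ?thesis by (simp add: restricted_voronoi_cell_eq)
qed

text \<open>The two radii are the outer radius \<open>R\<close> and the inner radius \<open>1/2\<close> of the cell, scaled by
  \<open>\<bar>\<tau>\<bar> ^ w\<close>; existence and uniqueness of digits hold because the restricted cell is a fundamental
  domain. The inequality in the hypothesis is the square of
  \<open>(\<bar>\<tau>\<bar> ^ (w - 1) + 2) * 2 R < \<bar>\<tau>\<bar> ^ w\<close>; as \<open>2 R \<ge> 1\<close>, it forces \<open>\<bar>\<tau>\<bar> > 1\<close>.\<close>

theorem mnr_digits_contracting:
  assumes w: "0 < w" and c: "(norm \<tau> ^ (w - 1) + 2)\<^sup>2 * circumdiameter_square < (norm \<tau> ^ w)\<^sup>2"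
  shows "contracting_digits (int_adjoin \<tau>) (mnr_digit_set \<tau> w) \<tau> w
    (norm \<tau> ^ w * sqrt circumdiameter_square / 2) (norm \<tau> ^ w / 2)"
proof -
  define \<delta> where "\<delta> = sqrt circumdiameter_square"
  have \<delta>: "1 \<le> \<delta>" "\<delta>\<^sup>2 = circumdiameter_square" using circumdiameter_ge_1 by (simp_all add: \<delta>_def)
  have "((norm \<tau> ^ (w - 1) + 2) * \<delta>)\<^sup>2 < (norm \<tau> ^ w)\<^sup>2"
    using c by (simp add: power_mult_distrib \<delta>)
  then have c': "(norm \<tau> ^ (w - 1) + 2) * \<delta> < norm \<tau> ^ w"
    by (rule power_less_imp_less_base) simp
  have "(norm \<tau> ^ (w - 1) + 2) * 1 \<le> (norm \<tau> ^ (w - 1) + 2) * \<delta>"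
    using \<delta> by (intro mult_left_mono) auto
  then have growth: "norm \<tau> ^ (w - 1) < norm \<tau> ^ w" using c' by simp
  have expanding: "1 < norm \<tau>"
  proof (rule ccontr)
    assume "\<not> 1 < norm \<tau>"
    then have "norm \<tau> ^ w \<le> norm \<tau> ^ (w - 1)" by (intro power_decreasing) auto
    then show False using growth by simp
  qed
  then have pos: "0 < norm \<tau> ^ w" by (intro zero_less_power) linarith
  then have nz: "\<tau> ^ w \<noteq> 0" by (auto simp flip: norm_power)
  have cell: "\<exists>a\<in>restricted_voronoi_cell \<tau>. d = \<tau> ^ w * a" if "d \<in> mnr_digit_set \<tau> w" for d
    using that ball_subset_restricted_cell[of 0] by (auto simp: mnr_digit_set_def)
  show ?thesis
  proof
    show "0 \<in> int_adjoin \<tau>" by (rule zero_int_adjoin)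
    fix x y assume "x \<in> int_adjoin \<tau>" "y \<in> int_adjoin \<tau>"
    then show "x - y \<in> int_adjoin \<tau>" by (rule int_adjoin_diff)
  next
    fix x assume "x \<in> int_adjoin \<tau>"
    then show "\<tau> * x \<in> int_adjoin \<tau>" "\<exists>k::nat. (norm x)\<^sup>2 = k"
      by (rule int_adjoin_base_mult, rule int_adjoin_norm_square)
  next
    show "0 \<in> mnr_digit_set \<tau> w" "mnr_digit_set \<tau> w \<subseteq> int_adjoin \<tau>"
      using zero_int_adjoin by (auto simp: mnr_digit_set_def)
  next
    fix d y assume "d \<in> mnr_digit_set \<tau> w" "d \<noteq> 0" "y \<in> int_adjoin \<tau>"
    then show "d \<noteq> \<tau> * y" by (auto simp: mnr_digit_set_def)
  next
    fix z assume z: "z \<in> int_adjoin \<tau>" "\<And>y. y \<in> int_adjoin \<tau> \<Longrightarrow> z \<noteq> \<tau> * y"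
    obtain y where y: "y \<in> int_adjoin \<tau>" "z / \<tau> ^ w - y \<in> restricted_voronoi_cell \<tau>"
      using restricted_cell_representative int_adjoin_discrete by blast
    define d where "d = z - \<tau> ^ w * y"
    have "d = \<tau> ^ w * (z / \<tau> ^ w - y)" using nz by (simp add: d_def right_diff_distrib)
    moreover have "d \<in> int_adjoin \<tau>" using z y by (simp add: d_def int_adjoin_diff int_adjoin_base_power)
    moreover have "d \<noteq> \<tau> * x" if x: "x \<in> int_adjoin \<tau>" for x
    proof
      assume "d = \<tau> * x"
      then have "z = \<tau> * (x - (0 - \<tau> ^ (w - 1) * y))"
        using w by (simp add: d_def algebra_simps flip: power_Suc)
      moreover have "x - (0 - \<tau> ^ (w - 1) * y) \<in> int_adjoin \<tau>"
        by (intro int_adjoin_diff int_adjoin_base_power zero_int_adjoin x y(1))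
      ultimately show False using z(2) by blast
    qed
    ultimately have "d \<in> mnr_digit_set \<tau> w" using y(2) by (auto simp: mnr_digit_set_def)
    moreover have "z = d + \<tau> ^ w * y" by (simp add: d_def)
    ultimately show "\<exists>d\<in>mnr_digit_set \<tau> w. \<exists>y\<in>int_adjoin \<tau>. z = d + \<tau> ^ w * y"
      using y(1) by blast
  next
    fix d d' y assume d: "d \<in> mnr_digit_set \<tau> w" "d' \<in> mnr_digit_set \<tau> w"
      and y: "y \<in> int_adjoin \<tau>" "d - d' = \<tau> ^ w * y"
    obtain a a' where a: "a \<in> restricted_voronoi_cell \<tau>" "a' \<in> restricted_voronoi_cell \<tau>"
      "d = \<tau> ^ w * a" "d' = \<tau> ^ w * a'"
      using cell d by metis
    then have "\<tau> ^ w * (a - a') = \<tau> ^ w * y" using y(2) by (simp add: right_diff_distrib)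
    then have "a - a' \<in> int_adjoin \<tau>" using y(1) mult_left_cancel[OF nz] by metis
    then show "d = d'" using restricted_cell_unique a by blast
  next
    fix d assume "d \<in> mnr_digit_set \<tau> w"
    then obtain a where a: "a \<in> restricted_voronoi_cell \<tau>" "d = \<tau> ^ w * a" using cell by blast
    then have "(2 * norm a)\<^sup>2 \<le> circumdiameter_square"
      using voronoi_cell_norm[of a] restricted_voronoi_cell_subset by (auto simp: power_mult_distrib)
    then have "2 * norm a \<le> \<delta>" unfolding \<delta>_def by (rule real_le_rsqrt)
    then have "norm \<tau> ^ w * (2 * norm a) \<le> norm \<tau> ^ w * \<delta>" by (intro mult_left_mono) auto
    then show "norm d \<le> norm \<tau> ^ w * sqrt circumdiameter_square / 2"
      by (simp add: a norm_mult norm_power \<delta>_def)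
  next
    fix z assume z: "z \<in> int_adjoin \<tau>" "\<And>y. y \<in> int_adjoin \<tau> \<Longrightarrow> z \<noteq> \<tau> * y" "norm z < norm \<tau> ^ w / 2"
    have "norm (z / \<tau> ^ w) < 1/2"
      using z(3) pos by (simp add: norm_divide norm_power divide_less_eq mult.commute)
    then have "z / \<tau> ^ w \<in> restricted_voronoi_cell \<tau>" by (rule ball_subset_restricted_cell)
    moreover have "z = \<tau> ^ w * (z / \<tau> ^ w)" using nz by simp
    ultimately have "z \<in> (\<lambda>x. \<tau> ^ w * x) ` restricted_voronoi_cell \<tau>" by blast
    then show "z \<in> mnr_digit_set \<tau> w" using z(1,2) unfolding mnr_digit_set_def by blast
  next
    show "norm \<tau> ^ w / 2 \<le> norm \<tau> ^ w * sqrt circumdiameter_square / 2"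
      using \<delta>(1) pos unfolding \<delta>_def by simp
    show "(norm \<tau> ^ (w - 1) + 2) * (norm \<tau> ^ w * sqrt circumdiameter_square / 2)
        < norm \<tau> ^ w * (norm \<tau> ^ w / 2)"
      using mult_strict_left_mono[OF c' pos] by (simp add: \<delta>_def mult_ac)
  qed (use expanding w in auto)
qed

subsection \<open>The numerical conditions\<close>

lemma height_le_iff: "(Im \<tau>)\<^sup>2 \<le> q - c / 4 \<longleftrightarrow> c \<le> (real_of_int p)\<^sup>2"
  by (simp add: Im_base)

lemma contraction_width2:
  assumes "(1 / sqrt q + 2 / q)\<^sup>2 * circumdiameter_square < 1"
  shows "(norm \<tau> ^ (2 - 1) + 2)\<^sup>2 * circumdiameter_square < (norm \<tau> ^ 2)\<^sup>2"
proof -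
  have norm: "sqrt q = norm \<tau>" using norm_base by (metis norm_ge_zero real_sqrt_unique)
  have "0 < sqrt q" using q_pos by simp
  then have "0 < norm \<tau>" unfolding norm .
  moreover have "1 / norm \<tau> + 2 / (norm \<tau>)\<^sup>2 = (norm \<tau> + 2) / (norm \<tau>)\<^sup>2"
    using \<open>0 < norm \<tau>\<close> by (simp add: field_simps power2_eq_square)
  ultimately show ?thesis
    using assms unfolding norm norm_base[symmetric] by (simp add: power_divide divide_less_eq)
qed

text \<open>Multiplication of the inequality for \<open>v\<close> by \<open>\<bar>\<tau>\<bar> ^ (2 (w - v)) \<ge> 1\<close>; only the summand \<open>2\<close> is enlarged.\<close>

lemma contraction_mono:
  assumes "0 < v" "v \<le> w" "1 \<le> norm \<tau>"
    and "(norm \<tau> ^ (v - 1) + 2)\<^sup>2 * circumdiameter_square < (norm \<tau> ^ v)\<^sup>2"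
  shows "(norm \<tau> ^ (w - 1) + 2)\<^sup>2 * circumdiameter_square < (norm \<tau> ^ w)\<^sup>2"
proof -
  define X where "X = norm \<tau> ^ (w - v)"
  have X: "1 \<le> X" using assms(3) by (simp add: X_def)
  have p: "norm \<tau> ^ w = X * norm \<tau> ^ v" "norm \<tau> ^ (w - 1) = X * norm \<tau> ^ (v - 1)"
    using assms(1,2) by (simp_all add: X_def flip: power_add)
  have "(norm \<tau> ^ (w - 1) + 2)\<^sup>2 * circumdiameter_square \<le> (X * (norm \<tau> ^ (v - 1) + 2))\<^sup>2 * circumdiameter_square"
    unfolding p using X circumdiameter_ge_1 by (intro mult_right_mono power_mono) (auto simp: algebra_simps)
  also have "\<dots> = X\<^sup>2 * ((norm \<tau> ^ (v - 1) + 2)\<^sup>2 * circumdiameter_square)"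
    by (simp add: power_mult_distrib)
  also have "\<dots> < X\<^sup>2 * (norm \<tau> ^ v)\<^sup>2"
    using assms(4) X by (intro mult_strict_left_mono) auto
  finally show ?thesis by (simp add: p power_mult_distrib)
qed

lemma circumdiameter_even:
  assumes "even p" "c \<le> (real_of_int p)\<^sup>2"
  shows "circumdiameter_square \<le> q - c / 4 + 1"
  using assms height_le_iff[of c] by (simp add: circumdiameter_square_def)

text \<open>The function \<open>s \<mapsto> (s + 1/4)\<^sup>2 / s\<close> increases for \<open>s \<ge> 1/4\<close>, so a lower bound on \<open>p\<^sup>2\<close> bounds the
  circumdiameter from above.\<close>

lemma circumdiameter_odd:
  assumes "odd p" "c \<le> (real_of_int p)\<^sup>2"
  shows "circumdiameter_square * (q - c / 4) \<le> (q - c / 4 + 1/4)\<^sup>2"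
proof -
  define s S where "s = (Im \<tau>)\<^sup>2" and "S = q - c / 4"
  have s: "3/4 \<le> s" "s \<le> S" using odd_height assms height_le_iff by (auto simp: s_def S_def)
  have "1/4 * (1/4) \<le> S * s" using s by (intro mult_mono) auto
  then have "0 \<le> (S - s) * (S * s - 1/16)" using s by (intro mult_nonneg_nonneg) auto
  then have "(s + 1/4)\<^sup>2 * S \<le> (S + 1/4)\<^sup>2 * s" by (simp add: power2_eq_square field_simps)
  then have "(s + 1/4)\<^sup>2 / s * S \<le> (S + 1/4)\<^sup>2" using s by (simp add: field_simps)
  then show ?thesis using assms(1) by (simp add: circumdiameter_square_def s_def S_def)
qed

lemma square_bounds:
  fixes n :: nat
  assumes "n \<le> \<bar>p\<bar>"
  shows "(real n)\<^sup>2 \<le> (real_of_int p)\<^sup>2" "(real n)\<^sup>2 < 4 * q"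
proof -
  have "real n \<le> \<bar>real_of_int p\<bar>" using assms by linarith
  then show "(real n)\<^sup>2 \<le> (real_of_int p)\<^sup>2" by (simp add: abs_le_square_iff[symmetric])
  then show "(real n)\<^sup>2 < 4 * q" using disc by linarith
qed

text \<open>By the bounds on the circumdiameter, this becomes a polynomial inequality in \<open>q\<close> once \<open>\<bar>\<tau>\<bar> = \<surd>q\<close>
  is replaced by its upper bound \<open>(q + 4) / 4\<close>.\<close>

lemma contraction_width4:
  assumes "3 \<le> \<bar>p\<bar>"
  shows "(norm \<tau> ^ (4 - 1) + 2)\<^sup>2 * circumdiameter_square < (norm \<tau> ^ 4)\<^sup>2"
proof -
  define Q X \<kappa> where "Q = real_of_int q" and "X = norm \<tau>" and "\<kappa> = circumdiameter_square"
  have X: "X * X = Q" using norm_base by (simp add: X_def Q_def power2_eq_square)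
  have \<kappa>: "0 < \<kappa>" using circumdiameter_ge_1 by (simp add: \<kappa>_def)
  have q: "3 \<le> Q" using square_bounds(2)[of 3] assms unfolding Q_def by simp
  have "(X ^ 3 + 2)\<^sup>2 = Q ^ 3 + 4 * (Q * X) + 4"
    by (simp add: X[symmetric] power2_eq_square power3_eq_cube algebra_simps)
  also have "\<dots> \<le> Q ^ 3 + Q\<^sup>2 + 4 * Q + 4"
  proof -
    \<comment> \<open>\<open>(X - 2)\<^sup>2 \<ge> 0\<close>\<close>
    have "4 * X \<le> Q + 4" using zero_le_power2[of "X - 2"] X by (simp add: power2_eq_square algebra_simps)
    then have "Q * (4 * X) \<le> Q * (Q + 4)" using q by (intro mult_left_mono) auto
    then show ?thesis by (simp add: power2_eq_square algebra_simps)
  qed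
  finally have "(X ^ 3 + 2)\<^sup>2 * \<kappa> \<le> (Q ^ 3 + Q\<^sup>2 + 4 * Q + 4) * \<kappa>"
    using \<kappa> by (intro mult_right_mono) auto
  also have "\<dots> < Q ^ 4"
  proof (cases "even p")
    case True
    then have "4 \<le> \<bar>p\<bar>" using assms by presburger
    then have "\<kappa> \<le> Q - 3"
      using circumdiameter_even[OF True, of 16] square_bounds(1)[of 4] by (simp add: \<kappa>_def Q_def)
    then have "(Q ^ 3 + Q\<^sup>2 + 4 * Q + 4) * \<kappa> \<le> (Q ^ 3 + Q\<^sup>2 + 4 * Q + 4) * (Q - 3)"
      using q by (intro mult_left_mono) auto
    also have "\<dots> = Q ^ 4 - (Q\<^sup>2 * (2 * Q - 1) + 8 * Q + 12)"
      by (simp add: algebra_simps power2_eq_square power3_eq_cube power4_eq_xxxx)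
    also have "\<dots> < Q ^ 4"
    proof -
      have "0 \<le> Q\<^sup>2 * (2 * Q - 1)" using q by simp
      then show ?thesis using q by linarith
    qed
    finally show ?thesis .
  next
    case False
    define S where "S = Q - 9/4"
    have S: "0 < S" using q by (simp add: S_def)
    have "\<kappa> * S \<le> (Q - 2)\<^sup>2"
      using circumdiameter_odd[OF False, of 9] square_bounds(1)[of 3] assms by (simp add: \<kappa>_def Q_def S_def)
    then have "(Q ^ 3 + Q\<^sup>2 + 4 * Q + 4) * \<kappa> * S \<le> (Q ^ 3 + Q\<^sup>2 + 4 * Q + 4) * (Q - 2)\<^sup>2"
      using q unfolding mult.assoc by (intro mult_left_mono) auto
    \<comment> \<open>The factor of \<open>Q\<^sup>2\<close> is a square plus \<open>8/3\<close>, and \<open>9 * 8/3 > 16\<close>.\<close>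
    also have "\<dots> = Q ^ 4 * S - (Q\<^sup>2 * (3/4 * (Q - 8/3)\<^sup>2 + 8/3) - 16)"
      unfolding S_def
      by (simp add: field_simps power2_eq_square power3_eq_cube power4_eq_xxxx)
    also have "\<dots> < Q ^ 4 * S"
    proof -
      have "3\<^sup>2 * (8/3) \<le> Q\<^sup>2 * (3/4 * (Q - 8/3)\<^sup>2 + 8/3)"
        using q by (intro mult_mono power_mono) auto
      then show ?thesis by simp
    qed
    finally show ?thesis using S by simp
  qed
  also have "\<dots> = (X ^ 4)\<^sup>2" by (simp add: X[symmetric] flip: power2_eq_square power_mult)
  finally show ?thesis by (simp add: X_def \<kappa>_def)
qed

text \<open>Since \<open>\<bar>\<tau>\<bar>\<^sup>2 = q\<close>, the claim is \<open>(q + 2)\<^sup>2 \<kappa> < q\<^sup>3\<close> for the squared circumdiameter \<open>\<kappa>\<close>. For \<open>\<bar>p\<bar> = 4\<close>, where \<open>\<kappa> = q - 3\<close>, it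
  amounts to \<open>q\<^sup>2 - 8 q - 12 < 0\<close>, which is why \<open>q \<le> 9\<close> is required.\<close>

lemma contraction_width3:
  assumes "5 \<le> \<bar>p\<bar> \<or> \<bar>p\<bar> = 4 \<and> q \<le> 9"
  shows "(norm \<tau> ^ (3 - 1) + 2)\<^sup>2 * circumdiameter_square < (norm \<tau> ^ 3)\<^sup>2"
proof -
  define Q \<kappa> where "Q = real_of_int q" and "\<kappa> = circumdiameter_square"
  have q: "5 \<le> Q" using square_bounds(2)[of 4] assms unfolding Q_def by auto
  have "(Q + 2)\<^sup>2 * \<kappa> < Q ^ 3"
  proof (cases "even p")
    case True
    show ?thesis
    proof (cases "\<bar>p\<bar> = 4")
      case four: True
      then have "q \<le> 9" using assms by auto
      then have "Q \<le> 9" by (simp add: Q_def)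
      have "\<kappa> \<le> Q - 3"
        using circumdiameter_even[OF True, of 16] square_bounds(1)[of 4] four by (simp add: \<kappa>_def Q_def)
      then have "(Q + 2)\<^sup>2 * \<kappa> \<le> (Q + 2)\<^sup>2 * (Q - 3)" by (intro mult_left_mono) auto
      also have "\<dots> = Q ^ 3 - (Q * (9 - Q) + (12 - Q))"
        by (simp add: algebra_simps power2_eq_square power3_eq_cube)
      also have "\<dots> < Q ^ 3"
      proof -
        have "0 \<le> Q * (9 - Q)" using q \<open>Q \<le> 9\<close> by simp
        then show ?thesis using \<open>Q \<le> 9\<close> by linarith
      qed
      finally show ?thesis .
    next
      case False
      then have "6 \<le> \<bar>p\<bar>" using assms True by presburger
      then have "\<kappa> \<le> Q - 8"
        using circumdiameter_even[OF True, of 36] square_bounds(1)[of 6] by (simp add: \<kappa>_def Q_def)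
      then have "(Q + 2)\<^sup>2 * \<kappa> \<le> (Q + 2)\<^sup>2 * (Q - 8)" by (intro mult_left_mono) auto
      also have "\<dots> = Q ^ 3 - (4 * Q\<^sup>2 + 28 * Q + 32)"
        by (simp add: algebra_simps power2_eq_square power3_eq_cube)
      also have "\<dots> < Q ^ 3" using q zero_le_power2[of Q] by linarith
      finally show ?thesis .
    qed
  next
    case False
    then have p: "5 \<le> \<bar>p\<bar>" using assms by presburger
    have q: "7 \<le> Q" using square_bounds(2)[of 5] p unfolding Q_def by simp
    define S where "S = Q - 25/4"
    have S: "0 < S" using q by (simp add: S_def)
    have "\<kappa> * S \<le> (Q - 6)\<^sup>2"
      using circumdiameter_odd[OF False, of 25] square_bounds(1)[of 5] p by (simp add: \<kappa>_def Q_def S_def)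
    then have "(Q + 2)\<^sup>2 * \<kappa> * S \<le> (Q + 2)\<^sup>2 * (Q - 6)\<^sup>2"
      unfolding mult.assoc by (intro mult_left_mono) auto
    \<comment> \<open>The difference is arranged so that each summand is non-negative for \<open>Q \<ge> 7\<close>.\<close>
    also have "\<dots> = Q ^ 3 * S - (7/4 * Q * (Q\<^sup>2 - 7\<^sup>2) + 8 * Q * (Q - 7) + 183/4 * (Q - 7) + 705/4)"
      unfolding S_def by (simp add: field_simps power2_eq_square power3_eq_cube)
    also have "\<dots> < Q ^ 3 * S"
    proof -
      have "7\<^sup>2 \<le> Q\<^sup>2" using q by (intro power_mono) auto
      then have "0 \<le> 7/4 * Q * (Q\<^sup>2 - 7\<^sup>2)" using q by (intro mult_nonneg_nonneg) auto
      then have "0 < 7/4 * Q * (Q\<^sup>2 - 7\<^sup>2) + 8 * Q * (Q - 7) + 183/4 * (Q - 7) + 705/4"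
        using q by (intro add_nonneg_pos add_nonneg_nonneg) simp_all
      then show ?thesis by (simp only: diff_less_eq less_add_same_cancel1)
    qed
    finally show ?thesis using S by simp
  qed
  moreover have "(norm \<tau> ^ 3)\<^sup>2 = Q ^ 3"
    unfolding Q_def norm_base[symmetric] by (simp flip: power_mult)
  ultimately show ?thesis by (simp add: norm_base Q_def \<kappa>_def)
qed

lemma even_width2_condition:
  "(1 / sqrt q + 2 / q)\<^sup>2 * (q - (real_of_int p)\<^sup>2 / 4 + 1) < 1 \<longleftrightarrow>
   \<bar>real_of_int p\<bar> > 2 * sqrt (real_of_int q + 1 - (real_of_int q)\<^sup>2 / (2 + sqrt q)\<^sup>2)"
proof -
  define X where "X = sqrt q"
  have X: "0 < X" "real_of_int q = X\<^sup>2" using q_pos by (simp_all add: X_def)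
  define P where "P = (real_of_int p)\<^sup>2"
  define Z where "Z = (X\<^sup>2)\<^sup>2 / (2 + X)\<^sup>2"
  have scale: "(A / B)\<^sup>2 * Y < 1 \<longleftrightarrow> Y < B\<^sup>2 / A\<^sup>2" if "0 < A" "0 < B" for A B Y :: real
    using that by (simp add: power_divide divide_less_eq less_divide_eq mult.commute)
  have "1 / X + 2 / X\<^sup>2 = (2 + X) / X\<^sup>2" using X by (simp add: field_simps power2_eq_square)
  then have "(1 / X + 2 / X\<^sup>2)\<^sup>2 * (X\<^sup>2 - P / 4 + 1) < 1 \<longleftrightarrow> X\<^sup>2 - P / 4 + 1 < Z"
    using X scale[of "2 + X" "X\<^sup>2"] by (simp add: Z_def)
  also have "\<dots> \<longleftrightarrow> 4 * (X\<^sup>2 + 1 - Z) < P" by auto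
  also have "\<dots> \<longleftrightarrow> sqrt (4 * (X\<^sup>2 + 1 - Z)) < sqrt P" by simp
  also have "\<dots> \<longleftrightarrow> 2 * sqrt (X\<^sup>2 + 1 - Z) < \<bar>real_of_int p\<bar>"
    by (simp only: P_def real_sqrt_mult real_sqrt_four real_sqrt_abs)
  finally show ?thesis unfolding X_def[symmetric] unfolding X(2) P_def Z_def .
qed

end

section \<open>Optimality of the non-adjacent form\<close>

theorem corollary7p2:
  fixes p q :: int and \<tau> :: complex and w :: nat
  assumes "real_of_int q - (real_of_int p)^2 / 4 > 0"
    and "\<tau>^2 - of_int p * \<tau> + of_int q = 0"
    and "w \<ge> 2"
  shows
    "(w = 2 \<and> even p \<longrightarrow>
        ((1 / sqrt (real_of_int q) + 2 / real_of_int q)^2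
            * (real_of_int q - (real_of_int p)^2 / 4 + 1) < 1
         \<longleftrightarrow>
         \<bar>real_of_int p\<bar> > 2 * sqrt (real_of_int q + 1
            - (real_of_int q)^2 / (2 + sqrt (real_of_int q))^2)))
     \<and>
     ((w \<ge> 4 \<and> \<bar>p\<bar> \<ge> 3)
      \<or> (w = 3 \<and> \<bar>p\<bar> \<ge> 5)
      \<or> (w = 3 \<and> \<bar>p\<bar> = 4 \<and> 5 \<le> q \<and> q \<le> 9)
      \<or> (w = 2 \<and> even p
          \<and> (1 / sqrt (real_of_int q) + 2 / real_of_int q)^2
              * (real_of_int q - (real_of_int p)^2 / 4 + 1) < 1)
      \<or> (w = 2 \<and> odd p
          \<and> (1 / sqrt (real_of_int q) + 2 / real_of_int q)^2
              * (real_of_int q - (real_of_int p)^2 / 4 + 1 / 4)^2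
              * inverse (real_of_int q - (real_of_int p)^2 / 4) < 1)
      \<longrightarrow>
      (\<forall>z \<in> int_adjoin \<tau>.
         (\<exists>!\<eta>. wnaf_expansion w (mnr_digit_set \<tau> w) \<tau> z \<eta>)
         \<and> (\<forall>\<eta>. wnaf_expansion w (mnr_digit_set \<tau> w) \<tau> z \<eta>
                \<longrightarrow> optimal_expansion (mnr_digit_set \<tau> w) \<tau> z \<eta>)))"
proof -
  interpret quadratic_integer p q \<tau>
    using assms(1,2) by unfold_locales
  let ?cond = "\<lambda>v. (norm \<tau> ^ (v - 1) + 2)\<^sup>2 * circumdiameter_square < (norm \<tau> ^ v)\<^sup>2"
  have optimal: "\<forall>z \<in> int_adjoin \<tau>. (\<exists>!\<eta>. wnaf_expansion w (mnr_digit_set \<tau> w) \<tau> z \<eta>)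
      \<and> (\<forall>\<eta>. wnaf_expansion w (mnr_digit_set \<tau> w) \<tau> z \<eta>
        \<longrightarrow> optimal_expansion (mnr_digit_set \<tau> w) \<tau> z \<eta>)" if "?cond w"
  proof -
    interpret contracting_digits "int_adjoin \<tau>" "mnr_digit_set \<tau> w" \<tau> w
      "norm \<tau> ^ w * sqrt circumdiameter_square / 2" "norm \<tau> ^ w / 2"
      using mnr_digits_contracting that assms(3) by simp
    show ?thesis using wnaf_optimal by blast
  qed
  have one: "1 \<le> norm \<tau>"
    using power2_le_imp_le[of 1 "norm \<tau>"] norm_base q_pos by simp
  have "?cond w" if "w \<ge> 4 \<and> \<bar>p\<bar> \<ge> 3"
    using that contraction_mono[of 4 w] contraction_width4 one by auto
  moreover have "?cond w" if "w = 3 \<and> \<bar>p\<bar> \<ge> 5 \<or> w = 3 \<and> \<bar>p\<bar> = 4 \<and> 5 \<le> q \<and> q \<le> 9"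
    using that contraction_width3 by auto
  moreover have "?cond w" if "w = 2 \<and> even p
      \<and> (1 / sqrt (real_of_int q) + 2 / real_of_int q)^2
        * (real_of_int q - (real_of_int p)^2 / 4 + 1) < 1"
    using that contraction_width2 by (auto simp: circumdiameter_square_def Im_base)
  moreover have "?cond w" if "w = 2 \<and> odd p
      \<and> (1 / sqrt (real_of_int q) + 2 / real_of_int q)^2
        * (real_of_int q - (real_of_int p)^2 / 4 + 1 / 4)^2
        * inverse (real_of_int q - (real_of_int p)^2 / 4) < 1"
  proof -
    have "circumdiameter_square = (real_of_int q - (real_of_int p)^2 / 4 + 1 / 4)^2
        * inverse (real_of_int q - (real_of_int p)^2 / 4)"
      using conjunct1[OF conjunct2[OF that]]
      by (simp only: circumdiameter_square_def Im_base divide_inverse if_False)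
    then have "(1 / sqrt q + 2 / q)\<^sup>2 * circumdiameter_square < 1"
      using that by (simp only: mult.assoc)
    moreover have "w = 2" using that ..
    ultimately show ?thesis using contraction_width2 by simp
  qed
  ultimately show ?thesis
    using optimal even_width2_condition by blast
qed

end
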